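(* Let $C$ and $C'$ be geodesic 5-cycles in the flip graph $\Gamma$ of $P_{n+3}$. Then $C\simeq_A C'$ (i.e. for suitable orientations of the cycles, $C$ and $C'$ represent the same element of $A_1^{n-2}(\mathcal{T}_n)^{ab}\cong H_1(X_\Gamma;\mathbb{Z})$) if and only if $L(C)=L(C')$.
   Context: $P_{n+3}$ is a convex $(n+3)$-gon with vertices labeled $1,\dots,n+3$. $\mathcal{T}_n$ is the simplicial complex on diagonals of $P_{n+3}$ whose simplices are sets of non-crossing diagonals. The flip graph $\Gamma$ has triangulations of $P_{n+3}$ as nodes and single diagonal flips as edges. $X_\Gamma$ is the 2-complex obtained from $\Gamma$ by attaching a 2-cell along every 3- and 4-cycle; the $(n-2)$-discrete fundamental group $A_1^{n-2}(\mathcal{T}_n)$ (loops of triangulations with consecutive ones equal or differing by a flip, modulo discrete homotopy) is isomorphic to $\pi_1(X_\Gamma)$, so its abelianization is $H_1(X_\Gamma;\mathbb{Z})$. A geodesic 5-cycle is the set of five triangulations containing a fixed set of $n-2$ non-crossing diagonals whose dissection of $P_{n+3}$ consists of triangles and exactly one pentagon; they form a 5-cycle in $\Gamma$. Its label $L(C)$ is the set of five vertices of that pentagon. *)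

theory Defs
  imports "HOL-Algebra.Generated_Groups"
begin

text \<open>
  A convex polygon is given by its finite set of vertices, which are natural numbers listed in
  cyclic order by increasing label; a segment between two vertices is a pair \<open>(i, j)\<close> with
  \<open>i < j\<close>. The second disjunct in \<open>polygon_edges\<close> is the edge that closes up the boundary,
  between the smallest and the largest vertex.
\<close>

type_synonym segment = "nat \<times> nat"

definition polygon_edges :: "nat set \<Rightarrow> segment set" where
  "polygon_edges S = {(i, j). i \<in> S \<and> j \<in> S \<and> i < j \<and>
     ((\<forall>k\<in>S. \<not> (i < k \<and> k < j)) \<or> (\<forall>k\<in>S. i \<le> k \<and> k \<le> j))}"

definition polygon_diagonals :: "nat set \<Rightarrow> segment set" where
  "polygon_diagonals S = {(i, j). i \<in> S \<and> j \<in> S \<and> i < j} - polygon_edges S"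

definition crossing :: "segment \<Rightarrow> segment \<Rightarrow> bool" where
  "crossing d e \<longleftrightarrow>
     (fst d < fst e \<and> fst e < snd d \<and> snd d < snd e) \<or>
     (fst e < fst d \<and> fst d < snd e \<and> snd e < snd d)"

definition P :: "nat \<Rightarrow> nat set" where
  "P n = {1..n + 3}"

text \<open>The simplices of \<open>\<T>\<^sub>n\<close> (the empty simplex included), and its facets.\<close>

definition noncrossing_sets :: "nat \<Rightarrow> segment set set" where
  "noncrossing_sets n =
     {D. D \<subseteq> polygon_diagonals (P n) \<and> (\<forall>d\<in>D. \<forall>e\<in>D. \<not> crossing d e)}"

definition triangulations :: "nat \<Rightarrow> segment set set" where
  "triangulations n = {T \<in> noncrossing_sets n. \<forall>D\<in>noncrossing_sets n. T \<subseteq> D \<longrightarrow> D = T}"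

definition flip :: "nat \<Rightarrow> segment set \<Rightarrow> segment set \<Rightarrow> bool" where
  "flip n T T' \<longleftrightarrow> T \<in> triangulations n \<and> T' \<in> triangulations n \<and>
     (\<exists>d\<in>T. \<exists>d'. d' \<notin> T \<and> T' = insert d' (T - {d}))"

definition near :: "nat \<Rightarrow> segment set \<Rightarrow> segment set \<Rightarrow> bool" where
  "near n T T' \<longleftrightarrow> T \<in> triangulations n \<and> (T = T' \<or> flip n T T')"

definition discrete_path :: "nat \<Rightarrow> segment set list \<Rightarrow> bool" where
  "discrete_path n w \<longleftrightarrow> w \<noteq> [] \<and> set w \<subseteq> triangulations n \<and> successively (near n) w"

definition discrete_loops :: "nat \<Rightarrow> segment set \<Rightarrow> segment set list set" where
  "discrete_loops n T\<^sub>0 = {w. discrete_path n w \<and> hd w = T\<^sub>0 \<and> last w = T\<^sub>0}"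

text \<open>
  Discrete homotopy of based loops: the equivalence relation generated by repeating an entry and
  by grids with two rows. A grid with more rows is a chain of grids with two rows.
\<close>

inductive discrete_homotopic ::
    "nat \<Rightarrow> segment set \<Rightarrow> segment set list \<Rightarrow> segment set list \<Rightarrow> bool"
  for n T\<^sub>0 where
  stretch: "\<lbrakk>u @ x # v \<in> discrete_loops n T\<^sub>0\<rbrakk>
      \<Longrightarrow> discrete_homotopic n T\<^sub>0 (u @ x # v) (u @ x # x # v)"
| grid: "\<lbrakk>w \<in> discrete_loops n T\<^sub>0; w' \<in> discrete_loops n T\<^sub>0; list_all2 (near n) w w'\<rbrakk>
      \<Longrightarrow> discrete_homotopic n T\<^sub>0 w w'"
| refl: "w \<in> discrete_loops n T\<^sub>0 \<Longrightarrow> discrete_homotopic n T\<^sub>0 w w"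
| sym: "discrete_homotopic n T\<^sub>0 w w' \<Longrightarrow> discrete_homotopic n T\<^sub>0 w' w"
| trans: "\<lbrakk>discrete_homotopic n T\<^sub>0 w w'; discrete_homotopic n T\<^sub>0 w' w''\<rbrakk>
      \<Longrightarrow> discrete_homotopic n T\<^sub>0 w w''"

definition homotopy_class ::
    "nat \<Rightarrow> segment set \<Rightarrow> segment set list \<Rightarrow> segment set list set" where
  "homotopy_class n T\<^sub>0 w = {w'. discrete_homotopic n T\<^sub>0 w w'}"

text \<open>The group \<open>A\<^sub>1\<^bsup>n-2\<^esup>(\<T>\<^sub>n, T\<^sub>0)\<close>, with multiplication induced by concatenation of loops.\<close>

definition A1 :: "nat \<Rightarrow> segment set \<Rightarrow> segment set list set monoid" where
  "A1 n T\<^sub>0 =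
     \<lparr>carrier = homotopy_class n T\<^sub>0 ` discrete_loops n T\<^sub>0,
      monoid.mult = (\<lambda>X Y. \<Union>x\<in>X. \<Union>y\<in>Y. homotopy_class n T\<^sub>0 (x @ tl y)),
      one = homotopy_class n T\<^sub>0 [T\<^sub>0]\<rparr>"

definition abelianization :: "('a, 'b) monoid_scheme \<Rightarrow> 'a set monoid" where
  "abelianization G = G Mod derived G (carrier G)"

text \<open>
  The elements of the abelianization that a closed walk \<open>w\<close>, based anywhere, represents: join
  \<open>w\<close> to the base point by a path. In the abelianization the choice of the path is irrelevant.
\<close>

definition represents_ab ::
    "nat \<Rightarrow> segment set \<Rightarrow> segment set list \<Rightarrow> segment set list set set \<Rightarrow> bool" where
  "represents_ab n T\<^sub>0 w g \<longleftrightarrow>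
     (\<exists>p. discrete_path n p \<and> hd p = T\<^sub>0 \<and> last p = hd w \<and>
        g = derived (A1 n T\<^sub>0) (carrier (A1 n T\<^sub>0))
              #>\<^bsub>A1 n T\<^sub>0\<^esub> homotopy_class n T\<^sub>0 (p @ tl w @ tl (rev p)))"

text \<open>
  The vertex sets of the cells into which a non-crossing set \<open>D\<close> dissects the polygon: the
  sub-polygons bounded by edges of the polygon and members of \<open>D\<close> and cut by no member of \<open>D\<close>.
\<close>

definition dissection_cells :: "nat \<Rightarrow> segment set \<Rightarrow> nat set set" where
  "dissection_cells n D = {S. S \<subseteq> P n \<and> 3 \<le> card S \<and>
     polygon_edges S \<subseteq> polygon_edges (P n) \<union> D \<and> polygon_diagonals S \<inter> D = {}}"

definition pentagon_dissection :: "nat \<Rightarrow> segment set \<Rightarrow> nat set \<Rightarrow> bool" where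
  "pentagon_dissection n D S \<longleftrightarrow>
     D \<in> noncrossing_sets n \<and> card D + 2 = n \<and>
     S \<in> dissection_cells n D \<and> card S = 5 \<and>
     (\<forall>S'\<in>dissection_cells n D. S' \<noteq> S \<longrightarrow> card S' = 3)"

definition geodesic_5_cycle_of :: "nat \<Rightarrow> segment set \<Rightarrow> segment set set" where
  "geodesic_5_cycle_of n D = {T \<in> triangulations n. D \<subseteq> T}"

definition geodesic_5_cycle :: "nat \<Rightarrow> segment set set \<Rightarrow> bool" where
  "geodesic_5_cycle n C \<longleftrightarrow> (\<exists>D S. pentagon_dissection n D S \<and> C = geodesic_5_cycle_of n D)"

text \<open>For a geodesic 5-cycle \<open>C\<close>, the set \<open>D\<close> below is determined by \<open>C\<close>: it is \<open>\<Inter>C\<close>.\<close>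

definition label :: "nat \<Rightarrow> segment set set \<Rightarrow> nat set" where
  "label n C = (THE S. \<exists>D. pentagon_dissection n D S \<and> C = geodesic_5_cycle_of n D)"

text \<open>A closed walk once around the 5-cycle \<open>C\<close>: a choice of starting point and orientation.\<close>

definition traverses :: "nat \<Rightarrow> segment set list \<Rightarrow> segment set set \<Rightarrow> bool" where
  "traverses n w C \<longleftrightarrow> length w = 6 \<and> hd w = last w \<and> distinct (butlast w) \<and> set w = C \<and>
     successively (flip n) w"

definition A_equivalent ::
    "nat \<Rightarrow> segment set \<Rightarrow> segment set set \<Rightarrow> segment set set \<Rightarrow> bool" where
  "A_equivalent n T\<^sub>0 C C' \<longleftrightarrow>
     (\<exists>w w'. traverses n w C \<and> traverses n w' C' \<and>
        (\<exists>g\<in>carrier (abelianization (A1 n T\<^sub>0)).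
           represents_ab n T\<^sub>0 w g \<and> represents_ab n T\<^sub>0 w' g))"

end

theory Submission
  imports Defs
begin

text \<open>
  If the labels agree, the two pentagons are equal, and the dissections differ only outside the
  pentagon. The triangulations containing a fixed non-crossing set are connected by flips, so one
  dissection is carried to the other by flips outside the pentagon; each such flip commutes with the
  five flips inside it and gives a grid between consecutive 5-cycles.

  Conversely, for crossing diagonals \<open>\<alpha>\<close>, \<open>\<beta>\<close> count with sign the steps of a loop that exchange
  \<open>\<alpha>\<close> and \<open>\<beta>\<close>. The count is additive and vanishes around closed walks of length four, hence
  it is a homomorphism from the abelianized group to the integers. If \<open>\<alpha>\<close>, \<open>\<beta>\<close> are crossing
  diagonals of a pentagon, the 5-cycle of the pentagon has count \<open>\<plusminus>1\<close>; a 5-cycle whose label misses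
  an endpoint of \<open>\<alpha>\<close> or \<open>\<beta>\<close> has count \<open>0\<close>.
\<close>

section \<open>Cyclic order and crossing segments\<close>

text \<open>Pairs of crossing diagonals are counted because the presence of a single diagonal is a
  function of the triangulation, so that its signed changes cancel around every closed walk. The
  count is blind to squares because a diagonal of a triangulation has only one possible replacement,
  and it sees a pentagon for a reason modulo 5: if cyclically consecutive diagonals are those that
  do not cross, each triangulation consists of diagonals k and k + 1, and the next flip replaces k
  by k + 2. Once around, i is exchanged for i + 2 exactly once, and the reverse exchange would need
  4 to vanish modulo 5. For the other direction, an arbitrary path of flips could destroy the
  pentagon. Connectedness is therefore proved relative to a set of diagonals kept throughout, and
  that set is chosen as the common part of two triangulations, one from each cycle, that agree
  inside the pentagon.\<close>

text \<open>The cyclic order of the labels replaces their linear order, so that every argument is invariant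
  under rotation of the polygon.\<close>

definition cyc :: "nat \<Rightarrow> nat \<Rightarrow> nat \<Rightarrow> bool" where
  "cyc a b c \<longleftrightarrow> (a < b \<and> b < c) \<or> (b < c \<and> c < a) \<or> (c < a \<and> a < b)"

text \<open>Stored segments are ordered pairs; this unordered form lets the two ends be swapped
  freely in rotation-invariant arguments.\<close>

definition seg :: "nat \<Rightarrow> nat \<Rightarrow> segment" where
  "seg a b = (min a b, max a b)"

lemma seg_commute: "seg a b = seg b a"
  by (simp add: seg_def min.commute max.commute)

lemma seg_eq_iff: "seg a b = seg c d \<longleftrightarrow> (a = c \<and> b = d) \<or> (a = d \<and> b = c)"
  by (auto simp: seg_def min_def max_def split: if_splits)

lemma seg_less: "a < b \<Longrightarrow> seg a b = (a, b)"
  by (simp add: seg_def)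

lemma crossing_commute: "crossing d e \<longleftrightarrow> crossing e d"
  by (auto simp: crossing_def)

lemma crossing_irrefl: "\<not> crossing d d"
  by (simp add: crossing_def)

lemma cyc_less: "a < b \<Longrightarrow> cyc a k b \<longleftrightarrow> a < k \<and> k < b"
  by (auto simp: cyc_def)

lemma cyc_greater: "a < b \<Longrightarrow> cyc b k a \<longleftrightarrow> k < a \<or> b < k"
  by (auto simp: cyc_def)

lemma cyc_simps [simp]: "\<not> cyc a a b" "\<not> cyc a b b" "\<not> cyc a b a"
  by (auto simp: cyc_def)

text \<open>The passage from linear to cyclic order: the ends of one segment lie on the two opposite
  open arcs cut off by the other.\<close>

lemma crossing_seg:
  "crossing (seg a b) (seg c d) \<longleftrightarrow> (cyc a c b \<and> cyc b d a) \<or> (cyc a d b \<and> cyc b c a)"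
  by (cases a b rule: linorder_cases; cases c d rule: linorder_cases)
    (auto simp: crossing_def seg_def cyc_less cyc_greater)

text \<open>Naming the ends by the arc they lie on saves later proofs a case distinction on which of
  \<open>i\<close> and \<open>j\<close> is where.\<close>

lemma crossing_segE:
  assumes "crossing (i, j) (seg a b)"
  obtains s t where "(i, j) = seg s t" "cyc a s b" "cyc b t a" "{s, t} = {i, j}"
proof -
  have "i < j"
    using assms by (auto simp: crossing_def)
  then have ij: "(i, j) = seg i j"
    by (simp add: seg_less)
  then have "crossing (seg a b) (seg i j)"
    using assms by (simp add: crossing_commute)
  then show thesis
    unfolding crossing_seg using that[of i j] that[of j i] ij seg_commute[of i j] by auto
qed

lemma crossing_segI: "cyc a s b \<Longrightarrow> cyc b t a \<Longrightarrow> crossing (seg s t) (seg a b)"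
  using crossing_seg[of a b s t] crossing_commute by blast

lemma crossing_segI': "cyc a s b \<Longrightarrow> cyc b t a \<Longrightarrow> crossing (seg t s) (seg a b)"
  using crossing_segI seg_commute by simp

lemma cyc_rotate: "cyc a b c \<Longrightarrow> cyc b c a"
  by (auto simp: cyc_def)

lemma cyc_trans:
  assumes "cyc a b c" "cyc a c d"
  shows "cyc a b d"
  using assms by (auto simp: cyc_def)

lemma cyc_sub: "cyc a b c \<Longrightarrow> cyc b x c \<Longrightarrow> cyc a x c"
  by (auto simp: cyc_def)

lemma cyc_opposite:
  assumes "cyc a b c" "cyc c x a"
  shows "cyc b x a" "cyc c x b"
  using assms by (auto simp: cyc_def)

lemma cyc_split:
  assumes "cyc a b c" "cyc a x c"
  shows "cyc a x b \<or> x = b \<or> cyc b x c"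
  using assms by (auto simp: cyc_def)

text \<open>In cyclic terms the closing edge is no longer special: an edge is a segment with an
  empty open arc on one side.\<close>

lemma seg_in_polygon_edges:
  "seg a b \<in> polygon_edges S \<longleftrightarrow> a \<in> S \<and> b \<in> S \<and> a \<noteq> b \<and>
     ((\<forall>k\<in>S. \<not> cyc a k b) \<or> (\<forall>k\<in>S. \<not> cyc b k a))"
proof (cases a b rule: linorder_cases)
  case less
  have "cyc a k b \<longleftrightarrow> a < k \<and> k < b" "cyc b k a \<longleftrightarrow> \<not> (a \<le> k \<and> k \<le> b)" for k
    using less by (auto simp: cyc_def)
  then show ?thesis
    using less by (auto simp: seg_less polygon_edges_def)
next
  case greater
  have "cyc b k a \<longleftrightarrow> b < k \<and> k < a" "cyc a k b \<longleftrightarrow> \<not> (b \<le> k \<and> k \<le> a)" for k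
    using greater by (auto simp: cyc_def)
  then show ?thesis
    using greater by (auto simp: seg_commute[of a b] seg_less polygon_edges_def)
qed (simp add: seg_def polygon_edges_def)

lemma seg_in_polygon_diagonals:
  "seg a b \<in> polygon_diagonals S \<longleftrightarrow> a \<in> S \<and> b \<in> S \<and> (\<exists>k\<in>S. cyc a k b) \<and> (\<exists>k\<in>S. cyc b k a)"
proof -
  have "seg a b \<in> {(i, j). i \<in> S \<and> j \<in> S \<and> i < j} \<longleftrightarrow> a \<in> S \<and> b \<in> S \<and> a \<noteq> b"
    by (auto simp: seg_def min_def max_def)
  moreover have "(\<exists>k\<in>S. cyc a k b) \<Longrightarrow> a \<noteq> b"
    by auto
  ultimately show ?thesis
    unfolding polygon_diagonals_def Diff_iff seg_in_polygon_edges by (metis (no_types, lifting))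
qed

text \<open>A crossing segment would have an end in each of the two open arcs, and one of them is
  empty.\<close>

lemma edge_not_crossed:
  assumes "seg a b \<in> polygon_edges S" "s \<in> S" "t \<in> S"
  shows "\<not> crossing (seg s t) (seg a b)"
proof
  assume "crossing (seg s t) (seg a b)"
  then have "crossing (seg a b) (seg s t)"
    by (simp only: crossing_commute)
  then show False
    using assms unfolding crossing_seg seg_in_polygon_edges by blast
qed

lemma segment_cases:
  assumes "e \<in> polygon_edges S \<union> polygon_diagonals S"
  obtains a b where "e = seg a b" "a \<in> S" "b \<in> S" "a < b" "e = (a, b)"
  using assms that by (auto simp: polygon_edges_def polygon_diagonals_def seg_less)


section \<open>Triangulations and flips\<close>

text \<open>Boundary edges are included so that a triangle of a triangulation can be described
  without asking which of its sides lie on the boundary.\<close>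

abbreviation sides :: "nat \<Rightarrow> segment set \<Rightarrow> segment set" where
  "sides n T \<equiv> T \<union> polygon_edges (P n)"

lemma finite_P: "finite (P n)"
  by (simp add: P_def)

lemma finite_diagonals: "finite (polygon_diagonals (P n))"
  by (rule finite_subset[of _ "P n \<times> P n"]) (auto simp: polygon_diagonals_def P_def)

lemma noncrossing_sets_finite: "D \<in> noncrossing_sets n \<Longrightarrow> finite D"
  using finite_diagonals finite_subset by (auto simp: noncrossing_sets_def)

lemma triangulation_noncrossing_set: "T \<in> triangulations n \<Longrightarrow> T \<in> noncrossing_sets n"
  by (simp add: triangulations_def)

lemma triangulation_finite: "T \<in> triangulations n \<Longrightarrow> finite T"
  by (blast intro: noncrossing_sets_finite triangulation_noncrossing_set)

lemma noncrossing_set_sides_noncrossing: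
  assumes T: "T \<in> noncrossing_sets n" and ef: "e \<in> sides n T" "f \<in> sides n T"
  shows "\<not> crossing e f"
proof -
  have *: "x \<in> polygon_edges (P n) \<union> polygon_diagonals (P n)" if "x \<in> sides n T" for x
    using that T by (auto simp: noncrossing_sets_def)
  obtain a b where e: "e = seg a b" "a \<in> P n" "b \<in> P n"
    using *[OF ef(1)] by (rule segment_cases)
  obtain c d where f: "f = seg c d" "c \<in> P n" "d \<in> P n"
    using *[OF ef(2)] by (rule segment_cases)
  show ?thesis
    using ef T edge_not_crossed[of a b "P n" c d] edge_not_crossed[of c d "P n" a b] e f
    by (auto simp: noncrossing_sets_def crossing_commute)
qed

lemmas triangulation_sides_noncrossing =
  noncrossing_set_sides_noncrossing[OF triangulation_noncrossing_set]

lemma triangulation_maximal: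
  assumes T: "T \<in> triangulations n" and e: "e \<in> polygon_diagonals (P n)"
    and nc: "\<And>f. f \<in> T \<Longrightarrow> \<not> crossing f e"
  shows "e \<in> T"
proof -
  have "\<forall>f\<in>T. \<not> crossing f e \<and> \<not> crossing e f"
    using nc crossing_commute by blast
  with T e have "insert e T \<in> noncrossing_sets n"
    by (simp add: triangulations_def noncrossing_sets_def crossing_irrefl)
  then show ?thesis
    using T by (auto simp: triangulations_def)
qed

lemma triangulationI:
  assumes "T \<in> noncrossing_sets n"
    and "\<And>e. e \<in> polygon_diagonals (P n) \<Longrightarrow> (\<And>f. f \<in> T \<Longrightarrow> \<not> crossing f e) \<Longrightarrow> e \<in> T"
  shows "T \<in> triangulations n"
proof -
  have "D = T" if "D \<in> noncrossing_sets n" "T \<subseteq> D" for D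
  proof
    show "D \<subseteq> T"
    proof
      fix e assume "e \<in> D"
      with that have "e \<in> polygon_diagonals (P n)" "\<And>f. f \<in> T \<Longrightarrow> \<not> crossing f e"
        by (auto simp: noncrossing_sets_def)
      then show "e \<in> T"
        by (rule assms(2))
    qed
  qed (rule that)
  then show ?thesis
    using assms(1) by (simp add: triangulations_def)
qed

lemma triangulation_sides_maximal:
  assumes T: "T \<in> triangulations n" and "a \<in> P n" "b \<in> P n" "a \<noteq> b" "seg a b \<notin> sides n T"
  obtains s t where "seg s t \<in> T" "s \<in> P n" "t \<in> P n" "cyc a s b" "cyc b t a"
proof -
  have "seg a b \<in> polygon_diagonals (P n)"
    using assms by (auto simp: seg_in_polygon_diagonals seg_in_polygon_edges)
  then obtain f where f: "f \<in> T" "crossing f (seg a b)"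
    using triangulation_maximal[OF T] assms by blast
  obtain i j where ij: "f = (i, j)"
    by (cases f)
  then have "i \<in> P n" "j \<in> P n"
    using f(1) T by (auto simp: triangulations_def noncrossing_sets_def polygon_diagonals_def)
  moreover obtain s t where "f = seg s t" "cyc a s b" "cyc b t a" "{s, t} = {i, j}"
    using crossing_segE f(2) unfolding ij by blast
  moreover from this have "s \<in> P n" "t \<in> P n"
    using \<open>i \<in> P n\<close> \<open>j \<in> P n\<close> by (auto simp: doubleton_eq_iff)
  ultimately show thesis
    using f(1) that by blast
qed

section \<open>Triangles, quadrilaterals and the uniqueness of a flip\<close>

text \<open>The number of vertices on an open arc is the measure in the extremal arguments below;
  cutting the arc at \<open>r\<close> loses at least \<open>r\<close> itself.\<close>

lemma card_arc_less:
  assumes "cyc a r b" "r \<in> P n"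
  shows "card {k \<in> P n. cyc a k r} < card {k \<in> P n. cyc a k b}"
    and "card {k \<in> P n. cyc r k b} < card {k \<in> P n. cyc a k b}"
proof -
  have "cyc a k b \<and> k \<noteq> r" if "cyc a k r \<or> cyc r k b" for k
    using that cyc_trans[of a k r b] cyc_sub[of a r b k] assms(1) by auto
  then have "{k \<in> P n. cyc a k r} \<subseteq> {k \<in> P n. cyc a k b} - {r}"
    "{k \<in> P n. cyc r k b} \<subseteq> {k \<in> P n. cyc a k b} - {r}"
    by blast+
  moreover have "r \<in> {k \<in> P n. cyc a k b}"
    using assms by simp
  ultimately have "{k \<in> P n. cyc a k r} \<subset> {k \<in> P n. cyc a k b}"
    "{k \<in> P n. cyc r k b} \<subset> {k \<in> P n. cyc a k b}"
    by blast+
  then show "card {k \<in> P n. cyc a k r} < card {k \<in> P n. cyc a k b}"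
    and "card {k \<in> P n. cyc r k b} < card {k \<in> P n. cyc a k b}"
    using finite_P by (simp_all add: psubset_card_mono)
qed

text \<open>The apex is the vertex \<open>r\<close> of the arc that is joined to \<open>p\<close> by
  a side and lies farthest from \<open>p\<close>. If \<open>r\<close> and \<open>q\<close> were not
  joined, a diagonal separating them would have to start at \<open>p\<close>, since it crosses
  neither \<open>seg p q\<close> nor \<open>seg p r\<close>, and it would end beyond
  \<open>r\<close>.\<close>

lemma triangle_on_side:
  assumes T: "T \<in> triangulations n" and pq: "seg p q \<in> sides n T" "p \<in> P n" "q \<in> P n"
    and k: "k \<in> P n" "cyc p k q"
  obtains r where "r \<in> P n" "cyc p r q" "seg p r \<in> sides n T" "seg r q \<in> sides n T"
proof -
  define R where "R = {r \<in> P n. cyc p r q \<and> seg p r \<in> sides n T}"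
  define m where "m r = card {k \<in> P n. cyc p k r}" for r
  obtain k0 where k0: "k0 \<in> P n" "cyc p k0 q"
    and k0_min: "\<And>y. y \<in> P n \<and> cyc p y q \<Longrightarrow> m k0 \<le> m y"
    using ex_has_least_nat[of "\<lambda>k. k \<in> P n \<and> cyc p k q" k m] k by auto
  \<comment> \<open>The vertex of the arc nearest to \<open>p\<close> is joined to it by a boundary
    edge, which makes \<open>R\<close> nonempty.\<close>
  have "\<not> cyc p y k0" if y: "y \<in> P n" for y
  proof
    assume "cyc p y k0"
    moreover have "cyc p y q"
      using \<open>cyc p y k0\<close> k0(2) by (auto simp: cyc_def)
    ultimately show False
      using k0_min[of y] card_arc_less(1)[of p y k0 n] y by (simp add: m_def)
  qed
  then have "seg p k0 \<in> polygon_edges (P n)"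
    using k0 pq by (auto simp: seg_in_polygon_edges)
  then have "k0 \<in> R"
    using k0 by (simp add: R_def)
  moreover have m_le: "m r < card (P n) + 1" for r
    using card_mono[OF finite_P, of "{k \<in> P n. cyc p k r}"] by (auto simp: m_def less_Suc_eq_le)
  ultimately obtain r where r: "r \<in> R" and r_max: "\<And>y. y \<in> R \<Longrightarrow> m y \<le> m r"
    using ex_has_greatest_nat[of "\<lambda>r. r \<in> R" k0 m "card (P n) + 1"] m_le by auto
  have r': "r \<in> P n" "cyc p r q" "seg p r \<in> sides n T"
    using r by (simp_all add: R_def)
  have "seg r q \<in> sides n T"
  proof (rule ccontr)
    assume not: "seg r q \<notin> sides n T"
    have "r \<noteq> q"
      using r' by auto
    from triangulation_sides_maximal[OF T r'(1) pq(3) this not]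
    obtain s t where st: "seg s t \<in> T" "s \<in> P n" "t \<in> P n" "cyc r s q" "cyc q t r" .
    have "\<not> crossing (seg s t) (seg p q)" "\<not> crossing (seg s t) (seg p r)"
      using triangulation_sides_noncrossing[OF T] st(1) pq(1) r'(3) by blast+
    moreover have psq: "cyc p s q" "cyc r s p" "cyc p r s"
      using r'(2) st(4) by (auto simp: cyc_def)
    moreover have "cyc q t p \<or> t = p \<or> cyc p t r"
      using cyc_split[of q p r t] r'(2) st(5) cyc_rotate by blast
    ultimately have "t = p"
      using crossing_segI[of p s q t] crossing_segI[of r s p t] seg_commute by metis
    then have "s \<in> R"
      using st psq by (auto simp: R_def seg_commute)
    then show False
      using r_max[of s] card_arc_less(1)[OF psq(3) r'(1)] by (simp add: m_def)
  qed
  then show thesis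
    using that r' by blast
qed

lemma diagonal_quadrilateral:
  assumes T: "T \<in> triangulations n" and ac: "seg a c \<in> T"
  obtains b d where "b \<in> P n" "d \<in> P n" "cyc a b c" "cyc c d a"
    "seg a b \<in> sides n T" "seg b c \<in> sides n T" "seg c d \<in> sides n T" "seg d a \<in> sides n T"
proof -
  have "seg a c \<in> polygon_diagonals (P n)"
    using T ac by (auto simp: triangulations_def noncrossing_sets_def)
  then obtain k l where "a \<in> P n" "c \<in> P n" "k \<in> P n" "cyc a k c" "l \<in> P n" "cyc c l a"
    by (auto simp: seg_in_polygon_diagonals)
  note k = this
  obtain b where "b \<in> P n" "cyc a b c" "seg a b \<in> sides n T" "seg b c \<in> sides n T"
    using triangle_on_side[OF T _ k(1,2,3,4)] ac by blast
  moreover obtain d where "d \<in> P n" "cyc c d a" "seg c d \<in> sides n T" "seg d a \<in> sides n T"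
    using triangle_on_side[OF T _ k(2,1,5,6)] ac seg_commute[of a c] by auto
  ultimately show thesis
    using that by blast
qed

text \<open>A segment that enters a triangle through \<open>seg a c\<close> and avoids the other two
  sides can only end at the opposite corner; this holds on both sides of
  \<open>seg a c\<close>.\<close>

lemma crossing_in_quadrilateral:
  assumes "cyc a b c" "cyc c d a" "crossing e (seg a c)"
    and "\<not> crossing e (seg a b)" "\<not> crossing e (seg b c)" "\<not> crossing e (seg c d)" "\<not> crossing e (seg d a)"
  shows "e = seg b d"
proof -
  obtain i j where "e = (i, j)"
    by (cases e)
  with assms obtain s t where e: "e = seg s t" "cyc a s c" "cyc c t a"
    by (metis crossing_segE)
  have "cyc b t a" "cyc c t b" "cyc d s c" "cyc a s d"
    using cyc_opposite[OF assms(1) e(3)] cyc_opposite[OF assms(2) e(2)] by auto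
  then have "\<not> cyc a s b" "\<not> cyc b s c" "\<not> cyc c t d" "\<not> cyc d t a"
    using assms(4-7) crossing_segI crossing_segI' e(1) by blast+
  then have "s = b" "t = d"
    using cyc_split[OF assms(1) e(2)] cyc_split[OF assms(2) e(3)] by auto
  then show ?thesis
    using e by simp
qed

text \<open>Read for the other diagonal, the same argument leaves \<open>seg a c\<close> as the only
  segment that crosses \<open>seg b d\<close> but no side. Hence \<open>seg b d\<close> fits the
  rest of a triangulation.\<close>

lemma quadrilateral_crossing:
  assumes "cyc a b c" "cyc c d a" "crossing e (seg b d)" "e \<noteq> seg a c"
  shows "crossing e (seg a c) \<or> crossing e (seg a b) \<or> crossing e (seg b c) \<or>
    crossing e (seg c d) \<or> crossing e (seg d a)"
proof (rule ccontr)
  assume nc: "\<not> ?thesis"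
  obtain i j where "e = (i, j)"
    by (cases e)
  with assms obtain s t where e: "e = seg s t" "cyc b s d" "cyc d t b"
    by (metis crossing_segE)
  have bcd: "cyc b c d" "cyc d a b"
    using assms(1,2) by (auto simp: cyc_def)
  have "cyc c t b" "cyc d t c" "cyc a s d" "cyc b s a"
    using cyc_opposite[OF bcd(1) e(3)] cyc_opposite[OF bcd(2) e(2)] by auto
  then have "\<not> cyc b s c" "\<not> cyc c s d" "\<not> cyc d t a" "\<not> cyc a t b"
    using nc crossing_segI crossing_segI' e(1) by blast+
  then have "s = c" "t = a"
    using cyc_split[OF bcd(1) e(2)] cyc_split[OF bcd(2) e(3)] by auto
  then show False
    using e assms(4) seg_commute by simp
qed

text \<open>A replacement must cross \<open>seg a c\<close>, since otherwise maximality would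
  already put it into \<open>T\<close>. It crosses no side of the quadrilateral, so it is the other
  diagonal.\<close>

lemma exchange_in_quadrilateral:
  assumes T: "T \<in> triangulations n" and ac: "seg a c \<in> T"
    and quad: "cyc a b c" "cyc c d a"
    and sides: "seg a b \<in> sides n T" "seg b c \<in> sides n T" "seg c d \<in> sides n T" "seg d a \<in> sides n T"
    and q: "q \<notin> T" "insert q (T - {seg a c}) \<in> triangulations n"
  shows "q = seg b d"
proof (rule crossing_in_quadrilateral[OF quad])
  have diag: "q \<in> polygon_diagonals (P n)"
    using q(2) by (auto simp: triangulations_def noncrossing_sets_def)
  have nc: "\<not> crossing q f" if "f \<in> sides n T" "f \<noteq> seg a c" for f
    using triangulation_sides_noncrossing[OF q(2), of q f] that by blast
  show "crossing q (seg a c)"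
  proof (rule ccontr)
    assume *: "\<not> crossing q (seg a c)"
    have "q \<in> T"
    proof (rule triangulation_maximal[OF T diag])
      fix f assume "f \<in> T"
      then show "\<not> crossing f q"
        using nc[of f] * crossing_commute by blast
    qed
    then show False
      using q(1) by simp
  qed
  have "a \<noteq> b" "b \<noteq> c" "c \<noteq> d" "d \<noteq> a"
    using quad by auto
  then show "\<not> crossing q (seg a b)" "\<not> crossing q (seg b c)" "\<not> crossing q (seg c d)" "\<not> crossing q (seg d a)"
    using nc sides by (auto simp: seg_eq_iff)
qed

lemma triangulation_diagonals: "T \<in> triangulations n \<Longrightarrow> T \<subseteq> polygon_diagonals (P n)"
  by (auto simp: triangulations_def noncrossing_sets_def)

lemma triangulation_segment:
  assumes "T \<in> triangulations n" "e \<in> T"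
  obtains a b where "e = seg a b" "a \<in> P n" "b \<in> P n" "e = (a, b)"
  using assms triangulation_diagonals segment_cases by (metis UnI2 subsetD)

lemma exchange_unique:
  assumes "T \<in> triangulations n" "p \<in> T"
    and "q \<notin> T" "insert q (T - {p}) \<in> triangulations n"
    and "q' \<notin> T" "insert q' (T - {p}) \<in> triangulations n"
  shows "q = q'"
proof -
  obtain a c where p: "p = seg a c"
    using assms(1,2) by (rule triangulation_segment)
  with assms obtain b d where "cyc a b c" "cyc c d a" "seg a b \<in> sides n T" "seg b c \<in> sides n T"
    "seg c d \<in> sides n T" "seg d a \<in> sides n T"
    using diagonal_quadrilateral by metis
  then show ?thesis
    using exchange_in_quadrilateral[of T n a c b d] assms p by metis
qed

lemma quadrilateral_flip:
  assumes T: "T \<in> triangulations n" and ac: "seg a c \<in> T"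
    and bd: "b \<in> P n" "d \<in> P n" and quad: "cyc a b c" "cyc c d a"
    and sides: "seg a b \<in> sides n T" "seg b c \<in> sides n T" "seg c d \<in> sides n T" "seg d a \<in> sides n T"
  shows "flip n T (insert (seg b d) (T - {seg a c}))"
proof -
  let ?T = "insert (seg b d) (T - {seg a c})"
  have ac': "a \<in> P n" "c \<in> P n"
    using triangulation_diagonals[OF T] ac seg_in_polygon_diagonals by blast+
  have bcd: "cyc b c d" "cyc d a b"
    using quad by (auto simp: cyc_def)
  then have diag: "seg b d \<in> polygon_diagonals (P n)"
    using bd ac' by (auto simp: seg_in_polygon_diagonals)
  have cross: "crossing (seg a c) (seg b d)"
    using quad by (simp add: crossing_seg)
  have notin: "seg b d \<notin> T"
    using cross triangulation_sides_noncrossing[OF T] ac by blast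
  have nc: "\<not> crossing e (seg b d)" if "e \<in> T - {seg a c}" for e
    using quadrilateral_crossing[OF quad, of e] that triangulation_sides_noncrossing[OF T, of e] sides ac
    by blast
  have "?T \<in> triangulations n"
  proof (rule triangulationI)
    have "\<forall>f\<in>T - {seg a c}. \<not> crossing f (seg b d) \<and> \<not> crossing (seg b d) f"
      using nc crossing_commute by blast
    then show "?T \<in> noncrossing_sets n"
      using triangulation_noncrossing_set[OF T] diag by (simp add: noncrossing_sets_def crossing_irrefl) blast
  next
    fix e assume e: "e \<in> polygon_diagonals (P n)" and enc: "\<And>f. f \<in> ?T \<Longrightarrow> \<not> crossing f e"
    \<comment> \<open>A compatible \<open>e\<close> that crosses the removed diagonal can only be
      \<open>seg b d\<close>. Any other one is in \<open>T\<close> by maximality, and it is not the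
      removed diagonal because that crosses \<open>seg b d\<close>.\<close>
    show "e \<in> ?T"
    proof (cases "crossing e (seg a c)")
      case True
      obtain i j where ij: "e = seg i j" "i \<in> P n" "j \<in> P n"
        using segment_cases[of e "P n"] e by blast
      have *: "\<not> crossing e f" if "f \<in> sides n T" "f \<noteq> seg a c" for f
      proof (cases "f \<in> polygon_edges (P n)")
        case True
        then obtain k l where "f = seg k l"
          using segment_cases[of f "P n"] by blast
        then show ?thesis
          using edge_not_crossed True ij by blast
      next
        case False
        then show ?thesis
          using enc[of f] that crossing_commute by blast
      qed
      have "a \<noteq> b" "b \<noteq> c" "c \<noteq> d" "d \<noteq> a"
        using quad by auto
      then have "\<not> crossing e (seg a b)" "\<not> crossing e (seg b c)" "\<not> crossing e (seg c d)" "\<not> crossing e (seg d a)"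
        using * sides by (auto simp: seg_eq_iff)
      then show ?thesis
        using crossing_in_quadrilateral[OF quad True] by simp
    next
      case False
      have "e \<in> T"
      proof (rule triangulation_maximal[OF T e])
        fix f assume "f \<in> T"
        then show "\<not> crossing f e"
          using False enc[of f] crossing_commute by blast
      qed
      moreover have "e \<noteq> seg a c"
        using enc[of "seg b d"] cross crossing_commute by blast
      ultimately show ?thesis
        by simp
    qed
  qed
  then show ?thesis
    unfolding flip_def using T ac notin by blast
qed

section \<open>Connectedness of the flip graph\<close>

text \<open>Let \<open>e\<close> join \<open>a\<close> and \<open>b\<close>. Among the diagonals of
  \<open>T\<close> crossing \<open>e\<close>, take \<open>seg q p\<close> with the fewest vertices
  on the arc from \<open>q\<close> to \<open>p\<close> that contains \<open>a\<close>. The triangle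
  over this arc has apex \<open>a\<close>, as any other apex yields a crossing diagonal with a
  smaller arc. Flipping \<open>seg q p\<close> therefore produces a diagonal that ends at
  \<open>a\<close>, and such a diagonal cannot cross \<open>e\<close>.\<close>

lemma flip_towards_diagonal:
  assumes T: "T \<in> triangulations n" and e: "e \<in> polygon_diagonals (P n)" "e \<notin> T"
  obtains p q where "p \<in> T" "crossing p e" "\<not> crossing q e" "flip n T (insert q (T - {p}))"
proof -
  obtain a b where ab: "e = seg a b" "a \<in> P n" "b \<in> P n"
    using segment_cases[of e "P n"] e by blast
  define good where "good = (\<lambda>(q, p). q \<in> P n \<and> p \<in> P n \<and> seg q p \<in> T \<and> cyc a p b \<and> cyc b q a)"
  define m where "m = (\<lambda>(q, p). card {k \<in> P n. cyc q k p})"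
  obtain x where x: "good x"
  proof -
    have "e \<notin> polygon_edges (P n)" "a \<noteq> b"
      using e(1) ab(1) by (auto simp: polygon_diagonals_def seg_def)
    with e ab have "seg a b \<notin> sides n T"
      by auto
    from triangulation_sides_maximal[OF T ab(2,3) \<open>a \<noteq> b\<close> this]
    obtain s t where "seg s t \<in> T" "s \<in> P n" "t \<in> P n" "cyc a s b" "cyc b t a" .
    then show thesis
      using that[of "(t, s)"] seg_commute[of s t] by (simp add: good_def)
  qed
  then obtain z where z: "good z" "\<And>y. good y \<Longrightarrow> m z \<le> m y"
    using ex_has_least_nat[of good x m] by blast
  obtain q p where qp_eq: "z = (q, p)"
    by (cases z)
  with z(1) have qp: "q \<in> P n" "p \<in> P n" "seg q p \<in> T" "cyc a p b" "cyc b q a"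
    by (auto simp: good_def)
  have qap: "cyc q a p"
    using qp(4,5) by (auto simp: cyc_def)
  obtain r where r: "r \<in> P n" "cyc q r p" "seg q r \<in> sides n T" "seg r p \<in> sides n T"
    using triangle_on_side[OF T _ qp(1,2) ab(2) qap] qp(3) by blast
  have "r = a"
  proof (rule ccontr)
    assume "r \<noteq> a"
    then consider "cyc q r a" | "cyc a r p"
      using cyc_split[OF qap r(2)] by blast
    then show False
    proof cases
      case 1
      have "cyc b r a"
        using 1 qp(5) cyc_sub by blast
      moreover have "seg r p \<in> T"
        using r(4) edge_not_crossed[of r p "P n" a b] ab crossing_segI[of a p b r] \<open>cyc b r a\<close> qp(4)
          seg_commute[of r p] crossing_commute by auto
      ultimately have "good (r, p)"
        using qp r by (simp add: good_def)
      then show False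
        using z(2)[of "(r, p)"] card_arc_less(2)[OF r(2,1)] by (simp add: m_def qp_eq)
    next
      case 2
      have "cyc a r b"
        using 2 qp(4) cyc_trans by blast
      moreover have "seg q r \<in> T"
        using r(3) edge_not_crossed[of q r "P n" a b] ab crossing_segI[of a r b q] \<open>cyc a r b\<close> qp(5)
          seg_commute[of r q] crossing_commute by auto
      ultimately have "good (q, r)"
        using qp r by (simp add: good_def)
      then show False
        using z(2)[of "(q, r)"] card_arc_less(1)[OF r(2,1)] by (simp add: m_def qp_eq)
    qed
  qed
  have pq: "seg p q \<in> T"
    using qp(3) seg_commute by metis
  have "cyc p b q"
    using qp(4,5) by (auto simp: cyc_def)
  then obtain c where c: "c \<in> P n" "cyc p c q" "seg p c \<in> sides n T" "seg c q \<in> sides n T"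
    using triangle_on_side[OF T _ qp(2,1) ab(3)] pq by blast
  have "flip n T (insert (seg a c) (T - {seg q p}))"
    using quadrilateral_flip[OF T qp(3) ab(2) c(1) qap c(2)] r(3,4) c(3,4) \<open>r = a\<close> by blast
  moreover have "crossing (seg q p) e"
    unfolding ab(1) using crossing_segI' qp(4,5) by blast
  moreover have "\<not> crossing (seg a c) e"
    unfolding ab(1) crossing_seg by simp
  ultimately show thesis
    using that qp(3) by blast
qed

text \<open>The flip graph of the triangulations that refine the dissection by
  \<open>F\<close>.\<close>

definition flip_keeping :: "nat \<Rightarrow> segment set \<Rightarrow> segment set \<Rightarrow> segment set \<Rightarrow> bool" where
  "flip_keeping n F T T' \<longleftrightarrow> flip n T T' \<and> F \<subseteq> T \<and> F \<subseteq> T'"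

lemma flip_triangulation: "flip n T T' \<Longrightarrow> T \<in> triangulations n \<and> T' \<in> triangulations n"
  by (simp add: flip_def)

text \<open>Each flip towards \<open>e\<close> lowers the number of diagonals crossing
  \<open>e\<close> and removes only such a diagonal, so the kept set survives.\<close>

lemma flips_to_diagonal:
  assumes "T \<in> triangulations n" "e \<in> polygon_diagonals (P n)" "F \<subseteq> T" "\<And>f. f \<in> F \<Longrightarrow> \<not> crossing f e"
  shows "\<exists>T'. (flip_keeping n F)\<^sup>*\<^sup>* T T' \<and> T' \<in> triangulations n \<and> insert e F \<subseteq> T'"
  using assms(1,3)
proof (induction "card {p \<in> T. crossing p e}" arbitrary: T rule: less_induct)
  case less
  show ?case
  proof (cases "e \<in> T")
    case True
    then show ?thesis
      using less.prems by blast
  next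
    case False
    obtain p q where pq: "p \<in> T" "crossing p e" "\<not> crossing q e" "flip n T (insert q (T - {p}))"
      using flip_towards_diagonal[OF less.prems(1) assms(2) False] .
    let ?T = "insert q (T - {p})"
    have "{x \<in> ?T. crossing x e} \<subset> {x \<in> T. crossing x e}"
    proof (rule psubsetI)
      show "{x \<in> ?T. crossing x e} \<subseteq> {x \<in> T. crossing x e}"
        using pq(3) by auto
      have "p \<in> {x \<in> T. crossing x e}"
        using pq(1,2) by simp
      moreover have "p \<notin> {x \<in> ?T. crossing x e}"
        using pq(2,3) by auto
      ultimately show "{x \<in> ?T. crossing x e} \<noteq> {x \<in> T. crossing x e}"
        by metis
    qed
    then have "card {x \<in> ?T. crossing x e} < card {x \<in> T. crossing x e}"
      using triangulation_finite[OF less.prems(1)] by (simp add: psubset_card_mono)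
    moreover have F: "F \<subseteq> ?T"
      using less.prems(2) assms(4) pq(2) by blast
    ultimately obtain T' where "(flip_keeping n F)\<^sup>*\<^sup>* ?T T'" "T' \<in> triangulations n" "insert e F \<subseteq> T'"
      using less.hyps[of ?T] flip_triangulation[OF pq(4)] by blast
    moreover have "flip_keeping n F T ?T"
      using pq(4) F less.prems(2) by (simp add: flip_keeping_def)
    ultimately show ?thesis
      by (meson converse_rtranclp_into_rtranclp)
  qed
qed

text \<open>The diagonals of the target are created one at a time, and each joins the kept set as
  soon as it is there.\<close>

lemma flips_connect:
  assumes "T \<in> triangulations n" "T' \<in> triangulations n" "F \<subseteq> T" "F \<subseteq> T'"
  shows "(flip_keeping n F)\<^sup>*\<^sup>* T T'"
  using assms(1,3,4)
proof (induction "card (T' - F)" arbitrary: T F rule: less_induct)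
  case less
  show ?case
  proof (cases "T' = F")
    case True
    then have "T = T'"
      using less.prems assms(2) by (auto simp: triangulations_def)
    then show ?thesis
      by simp
  next
    case False
    with less.prems obtain e where e: "e \<in> T'" "e \<notin> F"
      by blast
    have "e \<in> polygon_diagonals (P n)"
      using triangulation_diagonals assms(2) e by blast
    moreover have "\<not> crossing f e" if "f \<in> F" for f
      using triangulation_sides_noncrossing[OF assms(2)] that less.prems e by blast
    ultimately obtain T1 where T1: "(flip_keeping n F)\<^sup>*\<^sup>* T T1" "T1 \<in> triangulations n" "insert e F \<subseteq> T1"
      using flips_to_diagonal[OF less.prems(1) _ less.prems(2)] by blast
    have "T' - insert e F \<subset> T' - F"
      using e by blast
    then have "card (T' - insert e F) < card (T' - F)"
      using triangulation_finite[OF assms(2)] by (simp add: psubset_card_mono)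
    then have "(flip_keeping n (insert e F))\<^sup>*\<^sup>* T1 T'"
      using less.hyps T1 less.prems e by blast
    moreover have "flip_keeping n (insert e F) \<le> flip_keeping n F"
      by (auto simp: flip_keeping_def)
    ultimately have "(flip_keeping n F)\<^sup>*\<^sup>* T1 T'"
      using rtranclp_mono by blast
    then show ?thesis
      using T1(1) by simp
  qed
qed

section \<open>The number of diagonals of a triangulation\<close>

lemma flip_card:
  assumes "flip n T T'"
  shows "card T' = card T"
proof -
  obtain d d' where d: "d \<in> T" "d' \<notin> T" "T' = insert d' (T - {d})"
    using assms by (auto simp: flip_def)
  have "finite T"
    using assms flip_triangulation triangulation_finite by blast
  with d show ?thesis
    by (simp add: card_gt_0_iff) (metis card_gt_0_iff Suc_pred empty_iff)
qed

lemma fan_triangulation: "(\<lambda>j. (1, j)) ` {3..n + 2} \<in> triangulations n"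
proof (rule triangulationI)
  show "(\<lambda>j. (1, j)) ` {3..n + 2} \<in> noncrossing_sets n"
  proof -
    have "(1, j) \<in> polygon_diagonals (P n)" if j: "j \<in> {3..n + 2}" for j
    proof -
      have "cyc 1 2 j" "cyc j (n + 3) 1"
        using j by (auto simp: cyc_def)
      then have "seg 1 j \<in> polygon_diagonals (P n)"
        unfolding seg_in_polygon_diagonals using j by (force simp: P_def)
      then show ?thesis
        using j by (simp add: seg_less)
    qed
    then show ?thesis
      by (auto simp: noncrossing_sets_def crossing_def)
  qed
next
  fix e :: segment
  assume e: "e \<in> polygon_diagonals (P n)"
    and nc: "\<And>f. f \<in> (\<lambda>j. (1, j)) ` {3..n + 2} \<Longrightarrow> \<not> crossing f e"
  obtain i j where ij: "e = (i, j)" "i < j" "i \<in> P n" "j \<in> P n"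
    using e by (auto simp: polygon_diagonals_def)
  have notedge: "(i, j) \<notin> polygon_edges (P n)"
    using e ij by (auto simp: polygon_diagonals_def)
  have "j \<noteq> i + 1"
    using notedge ij by (auto simp: polygon_edges_def)
  then have j: "i + 2 \<le> j"
    using ij(2) by linarith
  show "e \<in> (\<lambda>j. (1, j)) ` {3..n + 2}"
  proof (cases "i = 1")
    case True
    have "j \<noteq> n + 3"
      using notedge ij True by (auto simp: polygon_edges_def P_def)
    then show ?thesis
      using ij j True by (auto simp: P_def)
  next
    case False
    \<comment> \<open>Since \<open>i + 2 \<le> j\<close>, the spoke to \<open>i + 1\<close> ends
      strictly between \<open>i\<close> and \<open>j\<close>; it starts at 1, which is smaller than
      \<open>i\<close>.\<close>
    have "(1, i + 1) \<in> (\<lambda>j. (1, j)) ` {3..n + 2}"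
      using False ij j by (auto simp: P_def)
    moreover have "crossing (1, i + 1) e"
      using False ij j by (auto simp: P_def crossing_def)
    ultimately show ?thesis
      using nc by blast
  qed
qed

text \<open>Flips preserve the cardinality, and connectedness reaches every triangulation from the
  fan at vertex 1.\<close>

lemma triangulation_card:
  assumes "T \<in> triangulations n"
  shows "card T = n"
proof -
  have "(flip_keeping n {})\<^sup>*\<^sup>* ((\<lambda>j. (1, j)) ` {3..n + 2}) T"
    using flips_connect fan_triangulation assms by blast
  then have "card T = card ((\<lambda>j. (1::nat, j)) ` {3..n + 2})"
    by induction (auto simp: flip_keeping_def flip_card)
  also have "\<dots> = n"
    by (subst card_image) (auto simp: inj_on_def)
  finally show ?thesis .
qed

lemma noncrossing_set_extends:
  assumes "D \<in> noncrossing_sets n"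
  obtains T where "T \<in> triangulations n" "D \<subseteq> T"
proof -
  have "card E \<le> card (polygon_diagonals (P n))" if "E \<in> noncrossing_sets n" for E
    using that card_mono[OF finite_diagonals] by (auto simp: noncrossing_sets_def)
  then obtain T where T: "T \<in> noncrossing_sets n" "D \<subseteq> T"
    and max: "\<And>E. E \<in> noncrossing_sets n \<and> D \<subseteq> E \<Longrightarrow> card E \<le> card T"
    using ex_has_greatest_nat[of "\<lambda>E. E \<in> noncrossing_sets n \<and> D \<subseteq> E" D card] assms
    by (metis (no_types, lifting) less_Suc_eq_le subset_refl)
  have "E = T" if "E \<in> noncrossing_sets n" "T \<subseteq> E" for E
    using card_seteq[OF noncrossing_sets_finite[OF that(1)] that(2)] max[of E] that T(2) by blast
  then have "T \<in> triangulations n"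
    using T(1) by (simp add: triangulations_def)
  then show thesis
    using that T(2) by blast
qed

text \<open>From here on a count can replace a proof of maximality.\<close>

lemma noncrossing_set_card_triangulation:
  assumes "D \<in> noncrossing_sets n" "card D = n"
  shows "D \<in> triangulations n"
proof -
  obtain T where T: "T \<in> triangulations n" "D \<subseteq> T"
    using noncrossing_set_extends assms by blast
  then have "D = T"
    using triangulation_card assms(2) triangulation_finite by (metis card_subset_eq)
  then show ?thesis
    using T by simp
qed

section \<open>Pentagons\<close>

lemma less_5_cases:
  assumes "(i::nat) < 5"
  obtains "i = 0" | "i = 1" | "i = 2" | "i = 3" | "i = 4"
  using assms by linarith

text \<open>The vertices stay fixed while \<open>D\<close> varies, as happens under flips outside
  the pentagon. The condition on \<open>card D\<close> stands for the other cells being triangles,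
  and increasing names let sides and diagonals be written as literal pairs.\<close>

locale pentagon =
  fixes n :: nat and D :: "segment set" and v0 v1 v2 v3 v4 :: nat
  assumes noncrossing: "D \<in> noncrossing_sets n" and card_D: "card D + 2 = n"
    and less: "v0 < v1" "v1 < v2" "v2 < v3" "v3 < v4"
    and in_P: "{v0, v1, v2, v3, v4} \<subseteq> P n"
    and pent_sides: "{(v0, v1), (v1, v2), (v2, v3), (v3, v4), (v0, v4)} \<subseteq> sides n D"
    and diags_notin: "{(v0, v2), (v0, v3), (v1, v3), (v1, v4), (v2, v4)} \<inter> D = {}"
begin

text \<open>The diagonals are listed so that cyclically consecutive ones are the non-crossing pairs.\<close>

definition diag :: "nat \<Rightarrow> segment" where
  "diag i = [(v0, v2), (v0, v3), (v1, v3), (v1, v4), (v2, v4)] ! (i mod 5)"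

text \<open>Passing from \<open>i\<close> to \<open>Suc i\<close> exchanges \<open>diag i\<close>
  for \<open>diag (i + 2)\<close>, so increasing indices run around the 5-cycle.\<close>

definition tri :: "nat \<Rightarrow> segment set" where
  "tri i = insert (diag i) (insert (diag (Suc i)) D)"

lemma diag_simps:
  "diag 0 = (v0, v2)" "diag 1 = (v0, v3)" "diag 2 = (v1, v3)" "diag 3 = (v1, v4)" "diag 4 = (v2, v4)"
  "diag (Suc 0) = (v0, v3)"
  by (simp_all add: diag_def)

lemma diag_cases: "diag i \<in> {(v0, v2), (v0, v3), (v1, v3), (v1, v4), (v2, v4)}"
proof -
  have "i mod 5 < 5"
    by simp
  then show ?thesis
    unfolding diag_def by (elim less_5_cases) simp_all
qed

lemma diag_mod: "diag (i mod 5) = diag i"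
  by (simp add: diag_def)

lemma diag_Suc_mod: "diag (Suc (i mod 5)) = diag (Suc i)"
  by (simp add: diag_def mod_Suc_eq)

lemma tri_mod: "tri (i mod 5) = tri i"
  by (simp add: tri_def diag_mod diag_Suc_mod)

lemma diag_eq_iff: "i < 5 \<Longrightarrow> j < 5 \<Longrightarrow> diag i = diag j \<longleftrightarrow> i = j"
  using less by (elim less_5_cases; hypsubst; simp add: diag_simps)

lemma crossing_diag_iff:
  "i < 5 \<Longrightarrow> j < 5 \<Longrightarrow> crossing (diag i) (diag j) \<longleftrightarrow> i \<noteq> j \<and> j \<noteq> Suc i mod 5 \<and> i \<noteq> Suc j mod 5"
  using less by (elim less_5_cases; hypsubst; simp add: diag_simps crossing_def)

lemma diag_notin: "diag i \<notin> D"
  using diags_notin diag_cases[of i] by blast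

lemma diag_in_diagonals: "diag i \<in> polygon_diagonals (P n)"
proof -
  have P: "v0 \<in> P n" "v1 \<in> P n" "v2 \<in> P n" "v3 \<in> P n" "v4 \<in> P n"
    using in_P by auto
  have "cyc v0 v1 v2" "cyc v2 v3 v0" "cyc v0 v1 v3" "cyc v3 v4 v0" "cyc v1 v2 v3" "cyc v3 v4 v1"
    "cyc v1 v2 v4" "cyc v4 v0 v1" "cyc v2 v3 v4" "cyc v4 v0 v2"
    using less by (simp_all add: cyc_less cyc_greater)
  then have "seg v0 v2 \<in> polygon_diagonals (P n)" "seg v0 v3 \<in> polygon_diagonals (P n)"
    "seg v1 v3 \<in> polygon_diagonals (P n)" "seg v1 v4 \<in> polygon_diagonals (P n)"
    "seg v2 v4 \<in> polygon_diagonals (P n)"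
    using P unfolding seg_in_polygon_diagonals by blast+
  then show ?thesis
    using diag_cases[of i] less by (auto simp: seg_less)
qed

text \<open>Such a segment meets the interior of the pentagon and crosses none of its sides, so it
  cannot end beyond a side: both its ends are vertices of the pentagon.\<close>

lemma crossing_diagD:
  assumes e: "e \<in> polygon_diagonals (P n)" and nc: "\<And>f. f \<in> D \<Longrightarrow> \<not> crossing e f"
    and cross: "crossing e (diag i)"
  shows "\<exists>j<5. e = diag j"
proof -
  obtain s t where st: "e = seg s t" "s \<in> P n" "t \<in> P n" "s < t" "e = (s, t)"
    using segment_cases[of e "P n"] e by blast
  have "\<not> crossing e f" if "f \<in> sides n D" for f
  proof (cases "f \<in> polygon_edges (P n)")
    case True
    then obtain k l where "f = seg k l"
      using segment_cases[of f "P n"] by blast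
    then show ?thesis
      using edge_not_crossed True st by blast
  qed (use nc that in blast)
  then have sides: "\<not> crossing (s, t) (v0, v1)" "\<not> crossing (s, t) (v1, v2)" "\<not> crossing (s, t) (v2, v3)"
    "\<not> crossing (s, t) (v3, v4)" "\<not> crossing (s, t) (v0, v4)"
    using pent_sides st(5) by auto
  obtain a b where d: "diag i = (a, b)"
    by (cases "diag i")
  then have ab: "crossing (s, t) (a, b)" "a \<in> {v0, v1, v2, v3, v4}" "b \<in> {v0, v1, v2, v3, v4}"
    using cross diag_cases[of i] st(5) by auto
  have gaps: "a \<le> v0 \<or> v1 \<le> a" "a \<le> v1 \<or> v2 \<le> a" "a \<le> v2 \<or> v3 \<le> a" "a \<le> v3 \<or> v4 \<le> a" "v0 \<le> a" "a \<le> v4"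
    "b \<le> v0 \<or> v1 \<le> b" "b \<le> v1 \<or> v2 \<le> b" "b \<le> v2 \<or> v3 \<le> b" "b \<le> v3 \<or> v4 \<le> b" "v0 \<le> b" "b \<le> v4"
    using ab(2,3) less by auto
  \<comment> \<open>Both \<open>a\<close> and \<open>b\<close> avoid the open gap from
    \<open>x\<close> to \<open>y\<close>. An end of \<open>(s, t)\<close> inside the gap would make
    \<open>(s, t)\<close>, which crosses \<open>(a, b)\<close>, cross \<open>(x, y)\<close>
    too.\<close>
  have not_gap: "\<not> (x < s \<and> s < y)" "\<not> (x < t \<and> t < y)"
    if "\<not> crossing (s, t) (x, y)" "a \<le> x \<or> y \<le> a" "b \<le> x \<or> y \<le> b" for x y
    using that ab(1) st(4) unfolding crossing_def fst_conv snd_conv by linarith+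
  \<comment> \<open>The fifth gap wraps around from \<open>v4\<close> to \<open>v0\<close> and takes
    a separate argument.\<close>
  have "v0 \<le> s" "t \<le> v4"
    using sides(5) ab(1) gaps(5,6,11,12) st(4) unfolding crossing_def fst_conv snd_conv by linarith+
  then have "v0 \<le> t" "s \<le> v4"
    using st(4) by auto
  note gap_free = not_gap[OF sides(1) gaps(1,7)] not_gap[OF sides(2) gaps(2,8)]
    not_gap[OF sides(3) gaps(3,9)] not_gap[OF sides(4) gaps(4,10)]
  have s: "s = v0 \<or> s = v1 \<or> s = v2 \<or> s = v3 \<or> s = v4"
    using \<open>v0 \<le> s\<close> \<open>s \<le> v4\<close> gap_free(1,3,5,7) by linarith
  have t: "t = v0 \<or> t = v1 \<or> t = v2 \<or> t = v3 \<or> t = v4"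
    using \<open>v0 \<le> t\<close> \<open>t \<le> v4\<close> gap_free(2,4,6,8) by linarith
  have "(s, t) \<in> {(v0, v1), (v1, v2), (v2, v3), (v3, v4), (v0, v4)} \<or> (\<exists>j<5. (s, t) = diag j)"
  proof -
    have "(s, t) \<in> {(v0, v1), (v1, v2), (v2, v3), (v3, v4), (v0, v4), diag 0, diag 1, diag 2, diag 3, diag 4}"
      using s t st(4) less by (elim disjE; simp add: diag_simps)
    moreover have "(0::nat) < 5" "(1::nat) < 5" "(2::nat) < 5" "(3::nat) < 5" "(4::nat) < 5"
      by simp_all
    ultimately show ?thesis
      by blast
  qed
  moreover have "(s, t) \<notin> {(v0, v1), (v1, v2), (v2, v3), (v3, v4), (v0, v4)}"
    using ab(1) diag_cases[of i] less unfolding d by (auto simp: crossing_def)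
  ultimately show ?thesis
    using st(5) by blast
qed

text \<open>A member of \<open>D\<close> that crossed a pentagon diagonal would itself be a pentagon
  diagonal, and \<open>D\<close> contains none.\<close>

lemma D_not_crossing_diag:
  assumes "f \<in> D"
  shows "\<not> crossing f (diag i)" "\<not> crossing (diag i) f"
proof -
  show "\<not> crossing f (diag i)"
    using crossing_diagD[of f i] diag_notin assms noncrossing by (auto simp: noncrossing_sets_def)
  then show "\<not> crossing (diag i) f"
    using crossing_commute by blast
qed

lemma tri_eq: "i < 5 \<Longrightarrow> tri i = insert (diag i) (insert (diag (Suc i mod 5)) D)"
  by (simp add: tri_def diag_mod)

lemma crossing_diag_Suc: "\<not> crossing (diag i) (diag (Suc i))"
proof -
  have "\<not> crossing (diag (i mod 5)) (diag (Suc i mod 5))"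
    by (subst crossing_diag_iff) (simp_all add: mod_Suc_eq)
  then show ?thesis
    by (simp add: diag_mod)
qed

lemma diag_Suc_neq: "diag i \<noteq> diag (Suc i)"
proof -
  have "diag (i mod 5) \<noteq> diag (Suc i mod 5)"
    by (subst diag_eq_iff) (auto simp: mod_Suc)
  then show ?thesis
    by (simp add: diag_mod)
qed

lemma tri_triangulation: "tri i \<in> triangulations n"
proof (rule noncrossing_set_card_triangulation)
  have "\<not> crossing (diag (Suc i)) (diag i)"
    using crossing_diag_Suc crossing_commute by blast
  then show "tri i \<in> noncrossing_sets n"
    using noncrossing diag_in_diagonals D_not_crossing_diag crossing_diag_Suc
    by (simp add: tri_def noncrossing_sets_def crossing_irrefl)
  show "card (tri i) = n"
    using noncrossing_sets_finite[OF noncrossing] diag_notin diag_Suc_neq card_D by (simp add: tri_def)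
qed

text \<open>By cardinality a triangulation containing \<open>D\<close> adds two diagonals. Both are
  pentagon diagonals and they do not cross, so their indices are consecutive.\<close>

lemma cycle_of_eq: "geodesic_5_cycle_of n D = tri ` {..<5}"
proof
  show "tri ` {..<5} \<subseteq> geodesic_5_cycle_of n D"
    using tri_triangulation by (auto simp: geodesic_5_cycle_of_def tri_def)
  show "geodesic_5_cycle_of n D \<subseteq> tri ` {..<5}"
  proof
    fix T assume "T \<in> geodesic_5_cycle_of n D"
    then have T: "T \<in> triangulations n" "D \<subseteq> T"
      by (auto simp: geodesic_5_cycle_of_def)
    have new: "\<exists>j<5. e = diag j" if "e \<in> T" "e \<notin> D" for e
    proof (rule ccontr)
      assume not: "\<not> ?thesis"
      have e: "e \<in> polygon_diagonals (P n)"
        using triangulation_diagonals[OF T(1)] that by blast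
      have nc: "\<not> crossing e f" if "f \<in> D" for f
        using triangulation_sides_noncrossing[OF T(1)] T(2) that \<open>e \<in> T\<close> by blast
      \<comment> \<open>If \<open>e\<close> were not a pentagon diagonal it would cross none of them
        either, so the maximality of \<open>tri 0\<close> would absorb it.\<close>
      have "e \<in> tri 0"
      proof (rule triangulation_maximal[OF tri_triangulation e])
        fix f assume "f \<in> tri 0"
        then show "\<not> crossing f e"
          using nc crossing_diagD[OF e nc] not crossing_commute unfolding tri_def by blast
      qed
      then have "e = diag 0 \<or> e = diag 1"
        using that(2) by (auto simp: tri_def)
      moreover have "(0::nat) < 5" "(1::nat) < 5"
        by simp_all
      ultimately show False
        using not by blast
    qed
    have "finite T" "finite D"
      using T(1) triangulation_finite noncrossing noncrossing_sets_finite by auto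
    then have "card (T - D) = 2"
      using triangulation_card[OF T(1)] card_D T(2) by (simp add: card_Diff_subset)
    then obtain e f where ef: "T - D = {e, f}" "e \<noteq> f"
      by (auto simp: card_2_iff)
    then obtain i j where ij: "i < 5" "j < 5" "e = diag i" "f = diag j"
      using new by (metis Diff_iff insertI1 insertI2)
    have "\<not> crossing e f"
      using triangulation_sides_noncrossing[OF T(1)] ef(1) by blast
    then have "j = Suc i mod 5 \<or> i = Suc j mod 5"
      using ij ef(2) crossing_diag_iff by blast
    moreover have "T = insert e (insert f D)"
      using ef T(2) by blast
    ultimately have "T = tri i \<or> T = tri j"
      using ij tri_eq insert_commute by metis
    then show "T \<in> tri ` {..<5}"
      using ij by blast
  qed
qed

lemma tri_Diff:
  assumes "i < 5" "j < 5" "i \<noteq> j" "j \<noteq> Suc i mod 5" "i \<noteq> Suc j mod 5"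
  shows "tri i - tri j = {diag i, diag (Suc i)}"
proof -
  have "{diag i, diag (Suc i)} \<inter> {diag j, diag (Suc j)} = {}"
  proof -
    have "Suc i mod 5 \<noteq> Suc j mod 5"
      using assms(1-3) by (auto simp: mod_Suc)
    then have "diag i \<noteq> diag j" "diag (Suc i mod 5) \<noteq> diag j"
      "diag i \<noteq> diag (Suc j mod 5)" "diag (Suc i mod 5) \<noteq> diag (Suc j mod 5)"
      using assms diag_eq_iff[of i j] diag_eq_iff[of "Suc i mod 5" j] diag_eq_iff[of i "Suc j mod 5"]
        diag_eq_iff[of "Suc i mod 5" "Suc j mod 5"] by auto
    then show ?thesis
      by (simp add: diag_mod)
  qed
  then show ?thesis
    using diag_notin by (auto simp: tri_def)
qed

text \<open>Triangulations at non-adjacent indices differ in two diagonals, whereas a flip removes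
  only one.\<close>

lemma flip_tri_adjacent:
  assumes "flip n (tri i) (tri j)" "i < 5" "j < 5"
  shows "j = Suc i mod 5 \<or> i = Suc j mod 5"
proof (rule ccontr)
  assume not: "\<not> ?thesis"
  obtain d d' where d: "d \<in> tri i" "d' \<notin> tri i" "tri j = insert d' (tri i - {d})"
    using assms(1) by (auto simp: flip_def)
  then have "i \<noteq> j"
    by auto
  then have "{diag i, diag (Suc i)} \<subseteq> {d}"
    using tri_Diff[of i j] not assms d by blast
  then show False
    using diag_Suc_neq by blast
qed

lemma flip_tri_Suc: "flip n (tri i) (tri (Suc i))"
proof -
  have "diag i \<noteq> diag (Suc (Suc i))"
  proof -
    have "i mod 5 \<noteq> Suc (Suc i) mod 5"
      by (auto simp: mod_Suc)
    then have "diag (i mod 5) \<noteq> diag (Suc (Suc i) mod 5)"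
      using diag_eq_iff[of "i mod 5" "Suc (Suc i) mod 5"] by simp
    then show ?thesis
      by (simp add: diag_mod)
  qed
  then have "diag (Suc (Suc i)) \<notin> tri i" "tri (Suc i) = insert (diag (Suc (Suc i))) (tri i - {diag i})"
    using diag_notin diag_Suc_neq[of i] diag_Suc_neq[of "Suc i"] by (auto simp: tri_def)
  moreover have "diag i \<in> tri i"
    by (simp add: tri_def)
  ultimately show ?thesis
    unfolding flip_def using tri_triangulation by blast
qed

lemma tri_inj: "inj_on tri {..<5}"
proof (rule inj_onI)
  fix i j :: nat
  assume ij: "i \<in> {..<5}" "j \<in> {..<5}" "tri i = tri j"
  show "i = j"
  proof (rule ccontr)
    assume "i \<noteq> j"
    consider "j = Suc i mod 5" | "i = Suc j mod 5" | "j \<noteq> Suc i mod 5" "i \<noteq> Suc j mod 5"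
      by blast
    then show False
    proof cases
      case 1
      then have "flip n (tri i) (tri j)"
        using flip_tri_Suc[of i] tri_mod[of "Suc i"] by simp
      then show False
        using ij by (auto simp: flip_def)
    next
      case 2
      then have "flip n (tri j) (tri i)"
        using flip_tri_Suc[of j] tri_mod[of "Suc j"] by simp
      then show False
        using ij by (auto simp: flip_def)
    next
      case 3
      then show False
        using tri_Diff[of i j] ij \<open>i \<noteq> j\<close> by auto
    qed
  qed
qed

text \<open>Recovering \<open>D\<close> from the cycle is what makes the label well defined. Already
  \<open>tri 0\<close> and \<open>tri 2\<close> have only \<open>D\<close> in common.\<close>

lemma Inter_cycle: "\<Inter> (geodesic_5_cycle_of n D) = D"
proof
  show "D \<subseteq> \<Inter> (geodesic_5_cycle_of n D)"
    by (auto simp: geodesic_5_cycle_of_def)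
  have "tri 0 - tri 2 = {diag 0, diag (Suc 0)}" "tri 2 - tri 0 = {diag 2, diag (Suc 2)}"
    by (simp_all add: tri_Diff)
  then have "tri 0 \<inter> tri 2 \<subseteq> D"
    by (auto simp: tri_def)
  then show "\<Inter> (geodesic_5_cycle_of n D) \<subseteq> D"
    unfolding cycle_of_eq by auto
qed

end

section \<open>The label of a geodesic 5-cycle\<close>

lemma card_5_sorted:
  assumes "card (S :: nat set) = 5"
  obtains v0 v1 v2 v3 v4 where "S = {v0, v1, v2, v3, v4}" "v0 < v1" "v1 < v2" "v2 < v3" "v3 < v4"
proof -
  have "finite S"
    using assms card.infinite by fastforce
  define xs where "xs = sorted_list_of_set S"
  have xs: "set xs = S" "sorted_wrt (<) xs" "length xs = 5"
    using \<open>finite S\<close> assms by (simp_all add: xs_def)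
  then obtain v0 v1 v2 v3 v4 where "xs = [v0, v1, v2, v3, v4]"
    by (auto simp: eval_nat_numeral length_Suc_conv)
  then show thesis
    using that[of v0 v1 v2 v3 v4] xs by auto
qed

lemma pentagon_dissection_pentagon:
  assumes pd: "pentagon_dissection n D S"
    and S: "S = {v0, v1, v2, v3, v4}" and less: "v0 < v1" "v1 < v2" "v2 < v3" "v3 < v4"
  shows "pentagon n D v0 v1 v2 v3 v4"
proof
  have cell: "S \<subseteq> P n" "polygon_edges S \<subseteq> sides n D" "polygon_diagonals S \<inter> D = {}"
    using pd by (auto simp: pentagon_dissection_def dissection_cells_def)
  have "seg v0 v1 \<in> polygon_edges S" "seg v1 v2 \<in> polygon_edges S" "seg v2 v3 \<in> polygon_edges S"
    "seg v3 v4 \<in> polygon_edges S" "seg v0 v4 \<in> polygon_edges S"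
    using less by (simp_all add: seg_in_polygon_edges S cyc_less cyc_greater)
  with cell(2) less show "{(v0, v1), (v1, v2), (v2, v3), (v3, v4), (v0, v4)} \<subseteq> sides n D"
    by (simp add: seg_less subset_iff)
  have "cyc v0 v1 v2" "cyc v2 v3 v0" "cyc v0 v1 v3" "cyc v3 v4 v0" "cyc v1 v2 v3" "cyc v3 v4 v1"
    "cyc v1 v2 v4" "cyc v4 v0 v1" "cyc v2 v3 v4" "cyc v4 v0 v2"
    using less by (simp_all add: cyc_less cyc_greater)
  then have "seg v0 v2 \<in> polygon_diagonals S" "seg v0 v3 \<in> polygon_diagonals S" "seg v1 v3 \<in> polygon_diagonals S"
    "seg v1 v4 \<in> polygon_diagonals S" "seg v2 v4 \<in> polygon_diagonals S"
    unfolding seg_in_polygon_diagonals S by blast+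
  with cell(3) less show "{(v0, v2), (v0, v3), (v1, v3), (v1, v4), (v2, v4)} \<inter> D = {}"
    by (auto simp: seg_less)
qed (use pd S less in \<open>auto simp: pentagon_dissection_def dissection_cells_def\<close>)

text \<open>The cycle determines \<open>D\<close> as its intersection, and \<open>D\<close> has only
  one cell with five vertices, the others being triangles.\<close>

lemma label_eq:
  assumes "pentagon_dissection n D S"
  shows "label n (geodesic_5_cycle_of n D) = S"
  unfolding label_def
proof (rule the_equality)
  show "\<exists>D'. pentagon_dissection n D' S \<and> geodesic_5_cycle_of n D = geodesic_5_cycle_of n D'"
    using assms by blast
next
  have Inter: "\<Inter> (geodesic_5_cycle_of n E) = E" if pd: "pentagon_dissection n E R" for E R
  proof -
    have "card R = 5"
      using pd by (simp add: pentagon_dissection_def)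
    then obtain v0 v1 v2 v3 v4 where v: "R = {v0, v1, v2, v3, v4}" "v0 < v1" "v1 < v2" "v2 < v3" "v3 < v4"
      by (rule card_5_sorted)
    interpret pentagon n E v0 v1 v2 v3 v4
      by (rule pentagon_dissection_pentagon[OF pd v])
    show ?thesis
      by (rule Inter_cycle)
  qed
  fix S' assume "\<exists>D'. pentagon_dissection n D' S' \<and> geodesic_5_cycle_of n D = geodesic_5_cycle_of n D'"
  then obtain D' where D': "pentagon_dissection n D' S'" "geodesic_5_cycle_of n D = geodesic_5_cycle_of n D'"
    by blast
  have "D = D'"
    using Inter[OF assms] Inter[OF D'(1)] unfolding D'(2) by metis
  then have "S' \<in> dissection_cells n D" "card S' = 5"
    using D'(1) by (simp_all add: pentagon_dissection_def)
  then show "S' = S"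
    using assms by (auto simp: pentagon_dissection_def)
qed

section \<open>The discrete fundamental group\<close>

lemma flip_sym:
  assumes "flip n T T'"
  shows "flip n T' T"
proof -
  obtain d d' where d: "d \<in> T" "d' \<notin> T" "T' = insert d' (T - {d})"
    using assms by (auto simp: flip_def)
  then have "d' \<in> T'" "d \<notin> T'" "T = insert d (T' - {d'})"
    by auto
  then show ?thesis
    using assms unfolding flip_def by blast
qed

lemma near_refl: "T \<in> triangulations n \<Longrightarrow> near n T T"
  by (simp add: near_def)

lemma near_sym: "near n T T' \<Longrightarrow> near n T' T"
  by (auto simp: near_def flip_sym dest: flip_triangulation)

lemma flip_near: "flip n T T' \<Longrightarrow> near n T T'"
  by (simp add: near_def flip_triangulation)

lemma near_triangulation: "near n T T' \<Longrightarrow> T \<in> triangulations n \<and> T' \<in> triangulations n"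
  by (auto simp: near_def dest: flip_triangulation)

lemma list_all2_near_refl: "set w \<subseteq> triangulations n \<Longrightarrow> list_all2 (near n) w w"
  by (simp add: list_all2_same near_refl subset_iff)

lemma discrete_path_append_iff:
  assumes "u \<noteq> []" "v \<noteq> []"
  shows "discrete_path n (u @ v) \<longleftrightarrow> discrete_path n u \<and> discrete_path n v \<and> near n (last u) (hd v)"
  using assms by (auto simp: discrete_path_def successively_append_iff)

lemma discrete_path_single: "discrete_path n [T] \<longleftrightarrow> T \<in> triangulations n"
  by (simp add: discrete_path_def)

lemma discrete_path_rev:
  assumes "discrete_path n p"
  shows "discrete_path n (rev p)"
proof -
  have "successively (\<lambda>x y. near n y x) p"
    using assms near_sym by (auto simp: discrete_path_def elim: successively_mono)
  then show ?thesis
    using assms by (simp add: discrete_path_def)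
qed

lemma discrete_path_concat:
  assumes p: "discrete_path n p" and q: "discrete_path n q" "last p = hd q"
  shows "discrete_path n (p @ tl q)"
proof (cases "tl q = []")
  case False
  then have "q = [hd q] @ tl q"
    using q by (simp add: discrete_path_def)
  then have "discrete_path n (tl q)" "near n (hd q) (hd (tl q))"
    using q(1) False discrete_path_append_iff[of "[hd q]" "tl q" n] by auto
  then show ?thesis
    using p q False discrete_path_append_iff[of p "tl q" n] by (auto simp: discrete_path_def)
qed (use p in simp)

lemma last_concat: "p \<noteq> [] \<Longrightarrow> q \<noteq> [] \<Longrightarrow> last p = hd q \<Longrightarrow> last (p @ tl q) = last q"
  by (cases q) (auto simp: last_append)

lemma loop_concat:
  assumes "x \<in> discrete_loops n T\<^sub>0" "y \<in> discrete_loops n T\<^sub>0"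
  shows "x @ tl y \<in> discrete_loops n T\<^sub>0"
proof -
  have "x \<noteq> []" "y \<noteq> []" "last x = hd y" "hd x = T\<^sub>0" "last y = T\<^sub>0"
    using assms by (auto simp: discrete_loops_def discrete_path_def)
  then show ?thesis
    using assms discrete_path_concat[of n x y] last_concat[of x y] by (simp add: discrete_loops_def)
qed

lemma stretch_loop:
  assumes "u @ x # v \<in> discrete_loops n T\<^sub>0"
  shows "u @ x # x # v \<in> discrete_loops n T\<^sub>0"
proof -
  have "x \<in> triangulations n"
    using assms by (auto simp: discrete_loops_def discrete_path_def)
  then have "successively (near n) (u @ x # x # v)"
    using assms near_refl[of x n] by (auto simp: discrete_loops_def discrete_path_def successively_append_iff)
  then show ?thesis
    using assms by (cases u) (auto simp: discrete_loops_def discrete_path_def)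
qed

lemma homotopic_loops:
  "discrete_homotopic n T\<^sub>0 w w' \<Longrightarrow> w \<in> discrete_loops n T\<^sub>0 \<and> w' \<in> discrete_loops n T\<^sub>0"
  by (induction rule: discrete_homotopic.induct) (auto simp: stretch_loop)

lemma homotopic_append_right:
  assumes "discrete_homotopic n T\<^sub>0 x x'" "y \<in> discrete_loops n T\<^sub>0"
  shows "discrete_homotopic n T\<^sub>0 (x @ tl y) (x' @ tl y)"
  using assms(1)
proof induction
  case (stretch u x v)
  then show ?case
    using discrete_homotopic.stretch[of u x "v @ tl y" n T\<^sub>0] loop_concat assms(2) by fastforce
next
  case (grid w w')
  have "set (tl y) \<subseteq> triangulations n"
    using assms(2) list.set_sel(2)[of y] by (auto simp: discrete_loops_def discrete_path_def)
  then show ?case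
    using grid loop_concat assms(2) by (intro discrete_homotopic.grid list_all2_appendI list_all2_near_refl) auto
qed (auto intro: discrete_homotopic.intros loop_concat assms(2))

lemma append_tl_eq: "x \<noteq> [] \<Longrightarrow> y \<noteq> [] \<Longrightarrow> last x = hd y \<Longrightarrow> x @ tl y = butlast x @ y"
  by (cases y; cases x rule: rev_cases) auto

lemma loop_append_tl:
  assumes "x \<in> discrete_loops n T\<^sub>0" "y \<in> discrete_loops n T\<^sub>0"
  shows "x @ tl y = butlast x @ y"
  using assms by (intro append_tl_eq) (auto simp: discrete_loops_def discrete_path_def)

lemma homotopic_append_left:
  assumes "discrete_homotopic n T\<^sub>0 y y'" "x \<in> discrete_loops n T\<^sub>0"
  shows "discrete_homotopic n T\<^sub>0 (x @ tl y) (x @ tl y')"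
  using assms(1)
proof induction
  case (stretch u z v)
  \<comment> \<open>In the form \<open>butlast x @ y\<close> the second factor is whole, so the
    repeated entry may also be its first one, which \<open>tl\<close> would drop.\<close>
  have "x @ tl (u @ z # v) = (butlast x @ u) @ z # v" "x @ tl (u @ z # z # v) = (butlast x @ u) @ z # z # v"
    using loop_append_tl[OF assms(2)] stretch stretch_loop by auto
  then show ?case
    using discrete_homotopic.stretch[of "butlast x @ u" z v n T\<^sub>0] loop_concat[OF assms(2) stretch] by simp
next
  case (grid w w')
  have "set (butlast x) \<subseteq> triangulations n"
    using assms(2) in_set_butlastD[of _ x] by (auto simp: discrete_loops_def discrete_path_def)
  then have "list_all2 (near n) (butlast x @ w) (butlast x @ w')"
    using grid by (intro list_all2_appendI list_all2_near_refl) auto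
  then show ?case
    using grid loop_concat[OF assms(2)] loop_append_tl[OF assms(2)] by (metis discrete_homotopic.grid)
qed (auto intro: discrete_homotopic.intros loop_concat assms(2))

lemma homotopic_concat:
  assumes "discrete_homotopic n T\<^sub>0 x x'" "discrete_homotopic n T\<^sub>0 y y'"
  shows "discrete_homotopic n T\<^sub>0 (x @ tl y) (x' @ tl y')"
  using homotopic_append_right[OF assms(1)] homotopic_append_left[OF assms(2)] homotopic_loops assms
  by (meson discrete_homotopic.trans)

lemma class_eq: "discrete_homotopic n T\<^sub>0 x y \<Longrightarrow> homotopy_class n T\<^sub>0 x = homotopy_class n T\<^sub>0 y"
  unfolding homotopy_class_def by (intro Collect_cong) (meson discrete_homotopic.sym discrete_homotopic.trans)

lemma class_self: "x \<in> discrete_loops n T\<^sub>0 \<Longrightarrow> x \<in> homotopy_class n T\<^sub>0 x"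
  by (simp add: homotopy_class_def discrete_homotopic.refl)

lemma carrier_A1: "carrier (A1 n T\<^sub>0) = homotopy_class n T\<^sub>0 ` discrete_loops n T\<^sub>0"
  by (simp add: A1_def)

text \<open>The product in \<open>A1\<close> is a union over all pairs of representatives.
  Concatenation respects homotopy, so all the united classes coincide.\<close>

lemma A1_mult:
  assumes "x \<in> discrete_loops n T\<^sub>0" "y \<in> discrete_loops n T\<^sub>0"
  shows "homotopy_class n T\<^sub>0 x \<otimes>\<^bsub>A1 n T\<^sub>0\<^esub> homotopy_class n T\<^sub>0 y = homotopy_class n T\<^sub>0 (x @ tl y)"
proof -
  let ?X = "homotopy_class n T\<^sub>0 x" and ?Y = "homotopy_class n T\<^sub>0 y"
  have eq: "homotopy_class n T\<^sub>0 (x' @ tl y') = homotopy_class n T\<^sub>0 (x @ tl y)" if "x' \<in> ?X" "y' \<in> ?Y" for x' y'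
  proof (rule class_eq)
    show "discrete_homotopic n T\<^sub>0 (x' @ tl y') (x @ tl y)"
      using that by (auto simp: homotopy_class_def intro: homotopic_concat discrete_homotopic.sym)
  qed
  have "?X \<otimes>\<^bsub>A1 n T\<^sub>0\<^esub> ?Y = (\<Union>x'\<in>?X. \<Union>y'\<in>?Y. homotopy_class n T\<^sub>0 (x' @ tl y'))"
    by (simp add: A1_def)
  also have "\<dots> = (\<Union>x'\<in>?X. \<Union>y'\<in>?Y. homotopy_class n T\<^sub>0 (x @ tl y))"
    by (intro SUP_cong eq HOL.refl)
  also have "\<dots> = homotopy_class n T\<^sub>0 (x @ tl y)"
    using class_self[OF assms(1)] class_self[OF assms(2)] by auto
  finally show ?thesis .
qed

lemma loop_backtrack:
  assumes "discrete_path n p" "hd p = T\<^sub>0"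
  shows "p @ tl (rev p) \<in> discrete_loops n T\<^sub>0"
  using assms discrete_path_concat[OF assms(1) discrete_path_rev[OF assms(1)]] last_concat[of p "rev p"]
  by (auto simp: discrete_loops_def discrete_path_def hd_rev last_rev)

text \<open>The tip \<open>y, x, y\<close> of the backtracking loop is entrywise near
  \<open>y, y, y\<close>, a stretched \<open>y\<close>. Removing tips one by one shrinks the loop to
  the base point.\<close>

lemma backtrack_homotopic:
  assumes "discrete_path n p" "hd p = T\<^sub>0"
  shows "discrete_homotopic n T\<^sub>0 (p @ tl (rev p)) [T\<^sub>0]"
  using assms
proof (induction p rule: rev_induct)
  case Nil
  then show ?case
    by (simp add: discrete_path_def)
next
  case (snoc x q)
  show ?case
  proof (cases "q = []")
    case True
    then show ?thesis
      using snoc.prems by (auto intro!: discrete_homotopic.refl simp: discrete_loops_def)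
  next
    case False
    then obtain r y where q: "q = r @ [y]"
      by (cases q rule: rev_cases) auto
    have path: "discrete_path n q" "near n y x"
      using snoc.prems(1) False discrete_path_append_iff[of q "[x]" n] by (auto simp: q)
    have hd: "hd q = T\<^sub>0"
      using snoc.prems(2) False by simp
    have loop1: "r @ y # rev r \<in> discrete_loops n T\<^sub>0"
      using loop_backtrack[OF path(1) hd] by (simp add: q)
    have stretched: "discrete_homotopic n T\<^sub>0 (r @ y # rev r) (r @ y # y # y # rev r)"
      using discrete_homotopic.stretch[OF loop1] discrete_homotopic.stretch[OF stretch_loop[OF loop1]]
      by (rule discrete_homotopic.trans)
    have loop2: "r @ y # x # y # rev r \<in> discrete_loops n T\<^sub>0"
      using loop_backtrack[OF snoc.prems] by (simp add: q)
    have "set r \<subseteq> triangulations n" "y \<in> triangulations n"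
      using path(1) by (auto simp: q discrete_path_def)
    then have "list_all2 (near n) (r @ y # x # y # rev r) (r @ y # y # y # rev r)"
      using near_sym[OF path(2)] near_refl[of y n]
      by (intro list_all2_appendI list_all2_near_refl) (auto intro!: list_all2_near_refl)
    then have "discrete_homotopic n T\<^sub>0 (r @ y # x # y # rev r) (r @ y # y # y # rev r)"
      using loop2 homotopic_loops[OF stretched] by (intro discrete_homotopic.grid) auto
    then have "discrete_homotopic n T\<^sub>0 (r @ y # x # y # rev r) (r @ y # rev r)"
      using stretched discrete_homotopic.sym discrete_homotopic.trans by meson
    moreover have "discrete_homotopic n T\<^sub>0 (r @ y # rev r) [T\<^sub>0]"
      using snoc.IH[OF path(1) hd] by (simp add: q)
    ultimately show ?thesis
      using discrete_homotopic.trans by (simp add: q)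
  qed
qed

lemma rev_loop: "w \<in> discrete_loops n T\<^sub>0 \<Longrightarrow> rev w \<in> discrete_loops n T\<^sub>0"
  using discrete_path_rev by (auto simp: discrete_loops_def hd_rev last_rev)

lemma A1_group:
  assumes "T\<^sub>0 \<in> triangulations n"
  shows "group (A1 n T\<^sub>0)"
proof (rule groupI)
  have unit: "[T\<^sub>0] \<in> discrete_loops n T\<^sub>0"
    using assms by (simp add: discrete_loops_def discrete_path_single)
  have one: "\<one>\<^bsub>A1 n T\<^sub>0\<^esub> = homotopy_class n T\<^sub>0 [T\<^sub>0]"
    by (simp add: A1_def)
  show "\<one>\<^bsub>A1 n T\<^sub>0\<^esub> \<in> carrier (A1 n T\<^sub>0)"
    using unit by (simp add: one carrier_A1)
  show "x \<otimes>\<^bsub>A1 n T\<^sub>0\<^esub> y \<in> carrier (A1 n T\<^sub>0)"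
    if "x \<in> carrier (A1 n T\<^sub>0)" "y \<in> carrier (A1 n T\<^sub>0)" for x y
    using that by (auto simp: carrier_A1 A1_mult loop_concat)
  show "x \<otimes>\<^bsub>A1 n T\<^sub>0\<^esub> y \<otimes>\<^bsub>A1 n T\<^sub>0\<^esub> z = x \<otimes>\<^bsub>A1 n T\<^sub>0\<^esub> (y \<otimes>\<^bsub>A1 n T\<^sub>0\<^esub> z)"
    if "x \<in> carrier (A1 n T\<^sub>0)" "y \<in> carrier (A1 n T\<^sub>0)" "z \<in> carrier (A1 n T\<^sub>0)" for x y z
  proof -
    obtain u v w where uvw: "x = homotopy_class n T\<^sub>0 u" "y = homotopy_class n T\<^sub>0 v" "z = homotopy_class n T\<^sub>0 w"
      "u \<in> discrete_loops n T\<^sub>0" "v \<in> discrete_loops n T\<^sub>0" "w \<in> discrete_loops n T\<^sub>0"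
      using \<open>x \<in> _\<close> \<open>y \<in> _\<close> \<open>z \<in> _\<close> by (auto simp: carrier_A1)
    have "v \<noteq> []"
      using uvw(5) by (simp add: discrete_loops_def discrete_path_def)
    then show ?thesis
      using uvw by (simp add: A1_mult loop_concat)
  qed
  show "\<one>\<^bsub>A1 n T\<^sub>0\<^esub> \<otimes>\<^bsub>A1 n T\<^sub>0\<^esub> x = x" if x: "x \<in> carrier (A1 n T\<^sub>0)" for x
  proof -
    obtain u where u: "x = homotopy_class n T\<^sub>0 u" "u \<in> discrete_loops n T\<^sub>0"
      using x by (auto simp: carrier_A1)
    then have "[T\<^sub>0] @ tl u = u"
      by (auto simp: discrete_loops_def discrete_path_def)
    then show ?thesis
      using A1_mult[OF unit u(2)] by (simp add: one u(1))
  qed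
  show "\<exists>y\<in>carrier (A1 n T\<^sub>0). y \<otimes>\<^bsub>A1 n T\<^sub>0\<^esub> x = \<one>\<^bsub>A1 n T\<^sub>0\<^esub>" if x: "x \<in> carrier (A1 n T\<^sub>0)" for x
  proof -
    obtain u where u: "x = homotopy_class n T\<^sub>0 u" "u \<in> discrete_loops n T\<^sub>0"
      using x by (auto simp: carrier_A1)
    \<comment> \<open>Backtracking along \<open>rev u\<close> yields \<open>rev u @ tl u\<close>, so
      the reversed loop is a left inverse.\<close>
    have "discrete_path n (rev u)" "hd (rev u) = T\<^sub>0"
      using rev_loop[OF u(2)] by (auto simp: discrete_loops_def)
    from class_eq[OF backtrack_homotopic[OF this]]
    have "homotopy_class n T\<^sub>0 (rev u) \<otimes>\<^bsub>A1 n T\<^sub>0\<^esub> x = \<one>\<^bsub>A1 n T\<^sub>0\<^esub>"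
      using A1_mult[OF rev_loop[OF u(2)] u(2)] by (simp add: one u(1))
    then show ?thesis
      using rev_loop[OF u(2)] by (auto simp: carrier_A1)
  qed
qed

lemma conjugate_loop:
  assumes "discrete_path n p" "hd p = T\<^sub>0" "last p = hd w" "discrete_path n w" "hd w = last w"
  shows "p @ tl w @ tl (rev p) \<in> discrete_loops n T\<^sub>0"
proof -
  have ne: "p \<noteq> []" "w \<noteq> []"
    using assms by (auto simp: discrete_path_def)
  have "discrete_path n (p @ tl w)" "last (p @ tl w) = last p"
    using discrete_path_concat[OF assms(1,4,3)] last_concat[OF ne assms(3)] assms by auto
  then have "discrete_path n ((p @ tl w) @ tl (rev p))" "last ((p @ tl w) @ tl (rev p)) = T\<^sub>0"
    using discrete_path_concat[of n "p @ tl w" "rev p"] discrete_path_rev[OF assms(1)]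
      last_concat[of "p @ tl w" "rev p"] ne assms(2) by (auto simp: hd_rev last_rev)
  then show ?thesis
    using ne assms(2) by (simp add: discrete_loops_def)
qed

text \<open>Repeating \<open>hd w\<close> at both ends of \<open>w\<close> turns the conjugate into
  \<open>p @ w @ rev p\<close>. Replacing \<open>w\<close> by \<open>w'\<close> there is a single
  grid, and the result is the conjugate of \<open>w'\<close> along the path prolonged by
  \<open>hd w'\<close>.\<close>

lemma grid_conjugate_homotopic:
  assumes p: "discrete_path n p" "hd p = T\<^sub>0" "last p = hd w"
    and w: "discrete_path n w" "hd w = last w" and w': "discrete_path n w'" "hd w' = last w'"
    and near: "list_all2 (near n) w w'"
  shows "discrete_path n (p @ [hd w'])"
    and "discrete_homotopic n T\<^sub>0 (p @ tl w @ tl (rev p)) ((p @ [hd w']) @ tl w' @ tl (rev (p @ [hd w'])))"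
proof -
  have ne: "p \<noteq> []" "w \<noteq> []" "w' \<noteq> []"
    using p w w' by (auto simp: discrete_path_def)
  have hd_near: "near n (hd w) (hd w')"
    using near ne by (cases w; cases w') auto
  then show path: "discrete_path n (p @ [hd w'])"
    using p ne near_triangulation by (simp add: discrete_path_append_iff discrete_path_single)
  obtain q x where q: "p = q @ [x]"
    using ne by (cases p rule: rev_cases) auto
  have x: "x = hd w"
    using p(3) by (simp add: q)
  obtain w2 where w2: "w = w2 @ [x]"
    using ne w(2) x by (cases w rule: rev_cases) auto
  have w1: "w = x # tl w"
    using ne x by simp
  have loop1: "q @ x # tl w @ rev q \<in> discrete_loops n T\<^sub>0"
    using conjugate_loop[OF p w] by (simp add: q)
  have eq: "q @ x # x # tl w @ rev q = (q @ x # w2) @ x # rev q"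
    using w1 w2 by (metis append.assoc append_Cons append_Nil)
  have eq2: "(q @ x # w2) @ x # x # rev q = p @ w @ rev p"
    using w2 by (simp add: q)
  have loop2: "(q @ x # w2) @ x # rev q \<in> discrete_loops n T\<^sub>0"
    using stretch_loop[OF loop1] by (simp only: eq)
  have "discrete_homotopic n T\<^sub>0 (q @ x # tl w @ rev q) ((q @ x # w2) @ x # rev q)"
    using discrete_homotopic.stretch[OF loop1] by (simp only: eq)
  moreover have "discrete_homotopic n T\<^sub>0 ((q @ x # w2) @ x # rev q) (p @ w @ rev p)"
    using discrete_homotopic.stretch[OF loop2] by (simp only: eq2)
  ultimately have h1: "discrete_homotopic n T\<^sub>0 (p @ tl w @ tl (rev p)) (p @ w @ rev p)"
    using discrete_homotopic.trans by (simp add: q)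
  have eq3: "(p @ [hd w']) @ tl w' @ tl (rev (p @ [hd w'])) = p @ w' @ rev p"
    using ne by (simp add: append_eq_Cons_conv) 
  have "hd (p @ [hd w']) = T\<^sub>0" "last (p @ [hd w']) = hd w'"
    using p(2) ne by auto
  then have loop3: "p @ w' @ rev p \<in> discrete_loops n T\<^sub>0"
    using conjugate_loop[OF path _ _ w'] unfolding eq3 by blast
  have "set p \<subseteq> triangulations n"
    using p(1) by (simp add: discrete_path_def)
  then have "list_all2 (near n) (p @ w @ rev p) (p @ w' @ rev p)"
    using near by (intro list_all2_appendI list_all2_near_refl) auto
  then have "discrete_homotopic n T\<^sub>0 (p @ w @ rev p) (p @ w' @ rev p)"
    using homotopic_loops[OF h1] loop3 by (intro discrete_homotopic.grid) auto
  then show "discrete_homotopic n T\<^sub>0 (p @ tl w @ tl (rev p)) ((p @ [hd w']) @ tl w' @ tl (rev (p @ [hd w'])))"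
    unfolding eq3 using h1 discrete_homotopic.trans by meson
qed

section \<open>Signed counts of flips\<close>

text \<open>An integral 1-cochain on the flip graph, which \<open>flip_sum\<close> evaluates on
  walks.\<close>

definition signed_flip :: "segment \<Rightarrow> segment \<Rightarrow> segment set \<Rightarrow> segment set \<Rightarrow> int" where
  "signed_flip \<alpha> \<beta> T T' = of_bool (\<alpha> \<in> T \<and> \<beta> \<in> T') - of_bool (\<beta> \<in> T \<and> \<alpha> \<in> T')"

fun flip_sum :: "segment \<Rightarrow> segment \<Rightarrow> segment set list \<Rightarrow> int" where
  "flip_sum \<alpha> \<beta> (T # T' # w) = signed_flip \<alpha> \<beta> T T' + flip_sum \<alpha> \<beta> (T' # w)"
| "flip_sum \<alpha> \<beta> _ = 0"

lemma signed_flip_anti: "signed_flip \<alpha> \<beta> T T' = - signed_flip \<alpha> \<beta> T' T"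
  by (auto simp: signed_flip_def)

lemma signed_flip_self: "signed_flip \<alpha> \<beta> T T = 0"
  by (auto simp: signed_flip_def)

lemma triangulation_crossing_notin:
  assumes "T \<in> triangulations n" "crossing \<alpha> \<beta>" "\<alpha> \<in> T"
  shows "\<beta> \<notin> T"
  using triangulation_sides_noncrossing[OF assms(1)] assms(2,3) by blast

text \<open>The first step must be the flip of \<alpha> into \<beta>. If the next flip removes
  \<beta>, uniqueness of the replacement brings \<alpha> back; otherwise \<beta> stays.\<close>

lemma neighbour_contains:
  assumes near: "near n T T'" "near n T' U" and cr: "crossing \<alpha> \<beta>" and in_T: "\<alpha> \<in> T" "\<beta> \<in> T'"
  shows "\<alpha> \<in> U \<or> \<beta> \<in> U"
proof -
  have tri: "T \<in> triangulations n" "T' \<in> triangulations n"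
    using near_triangulation[OF near(1)] by auto
  have notin: "\<beta> \<notin> T" "\<alpha> \<notin> T'"
    using triangulation_crossing_notin tri cr in_T crossing_commute by blast+
  then have "flip n T T'"
    using near(1) in_T by (auto simp: near_def)
  then obtain d d' where d: "d \<in> T" "d' \<notin> T" "T' = insert d' (T - {d})"
    by (auto simp: flip_def)
  then have "d' = \<beta>" "d = \<alpha>"
    using in_T notin by auto
  then have T: "T = insert \<alpha> (T' - {\<beta>})"
    using d by auto
  show ?thesis
  proof (cases "T' = U")
    case False
    then have flip: "flip n T' U"
      using near(2) by (simp add: near_def)
    then obtain e e' where e: "e \<in> T'" "e' \<notin> T'" "U = insert e' (T' - {e})"
      by (auto simp: flip_def)
    show ?thesis
    proof (cases "e = \<beta>")
      case True
      have "insert \<alpha> (T' - {\<beta>}) \<in> triangulations n" "insert e' (T' - {\<beta>}) \<in> triangulations n"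
        using tri(1) T flip_triangulation[OF flip] e True by auto
      then have "\<alpha> = e'"
        using exchange_unique[OF tri(2) in_T(2) notin(2) _ e(2)] by blast
      then show ?thesis
        using e by simp
    qed (use e in_T in auto)
  qed (use in_T in auto)
qed

text \<open>In a closed walk of length four, \<open>U\<close> and \<open>V\<close> are the two
  remaining vertices, so one exchange controls all four.\<close>

lemma signed_flip_neighbours:
  assumes "near n T T'" "near n T' U" "near n V T" "crossing \<alpha> \<beta>" "signed_flip \<alpha> \<beta> T T' \<noteq> 0"
  shows "\<forall>X\<in>{T, T', U, V}. \<alpha> \<in> X \<or> \<beta> \<in> X"
proof -
  consider "\<alpha> \<in> T" "\<beta> \<in> T'" | "\<beta> \<in> T" "\<alpha> \<in> T'"
    using assms(5) by (auto simp: signed_flip_def of_bool_def split: if_splits)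
  then show ?thesis
  proof cases
    case 1
    then show ?thesis
      using neighbour_contains[OF assms(1,2,4)] crossing_commute[of \<alpha> \<beta>] assms(4)
        neighbour_contains[OF near_sym[OF assms(1)] near_sym[OF assms(3)], of \<beta> \<alpha>] by auto
  next
    case 2
    then show ?thesis
      using neighbour_contains[OF assms(1,2), of \<beta> \<alpha>] crossing_commute[of \<alpha> \<beta>] assms(4)
        neighbour_contains[OF near_sym[OF assms(1)] near_sym[OF assms(3)], of \<alpha> \<beta>] by auto
  qed
qed

text \<open>Where exactly one of the two segments is present, the cochain is the coboundary of the
  indicator of \<beta>.\<close>

lemma signed_flip_telescopes:
  assumes "T \<in> triangulations n" "T' \<in> triangulations n" "crossing \<alpha> \<beta>"
    and "\<alpha> \<in> T \<or> \<beta> \<in> T" "\<alpha> \<in> T' \<or> \<beta> \<in> T'"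
  shows "signed_flip \<alpha> \<beta> T T' = of_bool (\<beta> \<in> T') - of_bool (\<beta> \<in> T)"
  using assms triangulation_crossing_notin[OF assms(1,3)] triangulation_crossing_notin[OF assms(2,3)]
  by (auto simp: signed_flip_def)

text \<open>If some step of a closed walk of length four exchanges the crossing diagonals, then by the
  uniqueness of flips all its four triangulations contain one of the two, and the sum telescopes.\<close>

lemma signed_flip_square:
  assumes near: "near n T1 T2" "near n T2 T3" "near n T3 T4" "near n T4 T1" and cr: "crossing \<alpha> \<beta>"
  shows "signed_flip \<alpha> \<beta> T1 T2 + signed_flip \<alpha> \<beta> T2 T3 + signed_flip \<alpha> \<beta> T3 T4 + signed_flip \<alpha> \<beta> T4 T1 = 0"
proof (cases "signed_flip \<alpha> \<beta> T1 T2 = 0 \<and> signed_flip \<alpha> \<beta> T2 T3 = 0 \<and> signed_flip \<alpha> \<beta> T3 T4 = 0 \<and> signed_flip \<alpha> \<beta> T4 T1 = 0")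
  case False
  then have "\<forall>X\<in>{T1, T2, T3, T4}. \<alpha> \<in> X \<or> \<beta> \<in> X"
    using signed_flip_neighbours[OF near(1,2,4) cr] signed_flip_neighbours[OF near(2,3,1) cr]
      signed_flip_neighbours[OF near(3,4,2) cr] signed_flip_neighbours[OF near(4,1,3) cr] by blast
  moreover have "T1 \<in> triangulations n" "T2 \<in> triangulations n" "T3 \<in> triangulations n" "T4 \<in> triangulations n"
    using near_triangulation[OF near(1)] near_triangulation[OF near(3)] by auto
  ultimately show ?thesis
    using signed_flip_telescopes[OF _ _ cr] by simp
qed simp

section \<open>Homotopy invariance of the signed count\<close>

text \<open>Adding up the squares between the two rows cancels the inner columns. For based loops
  the outer columns are constant and contribute nothing.\<close>

lemma flip_sum_grid:
  assumes "list_all2 (near n) w w'" "w \<noteq> []" "successively (near n) w" "successively (near n) w'" "crossing \<alpha> \<beta>"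
  shows "flip_sum \<alpha> \<beta> w + signed_flip \<alpha> \<beta> (last w) (last w') = signed_flip \<alpha> \<beta> (hd w) (hd w') + flip_sum \<alpha> \<beta> w'"
  using assms
proof (induction w w' rule: list_all2_induct)
  case (Cons x w y w')
  show ?case
  proof (cases "w = []")
    case True
    then show ?thesis
      using Cons by simp
  next
    case False
    then obtain a u b u' where w: "w = a # u" "w' = b # u'"
      using Cons.hyps(2) by (cases w; cases w') auto
    have near: "near n x a" "near n a b" "near n b y" "near n y x"
      using Cons.prems Cons.hyps near_sym by (auto simp: w)
    have "signed_flip \<alpha> \<beta> x a + signed_flip \<alpha> \<beta> a b = signed_flip \<alpha> \<beta> x y + signed_flip \<alpha> \<beta> y b"
      using signed_flip_square[OF near assms(5)] signed_flip_anti[of \<alpha> \<beta> b y] signed_flip_anti[of \<alpha> \<beta> y x] by linarith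
    moreover have "flip_sum \<alpha> \<beta> w + signed_flip \<alpha> \<beta> (last w) (last w') = signed_flip \<alpha> \<beta> (hd w) (hd w') + flip_sum \<alpha> \<beta> w'"
      using Cons.IH Cons.prems False by (auto simp: w)
    ultimately show ?thesis
      by (simp add: w)
  qed
qed simp

lemma flip_sum_append: "flip_sum \<alpha> \<beta> (u @ x # v) = flip_sum \<alpha> \<beta> (u @ [x]) + flip_sum \<alpha> \<beta> (x # v)"
proof (induction u)
  case (Cons a u)
  then show ?case
    by (cases u) auto
qed simp

lemma flip_sum_concat:
  assumes "x \<noteq> []" "y \<noteq> []" "last x = hd y"
  shows "flip_sum \<alpha> \<beta> (x @ tl y) = flip_sum \<alpha> \<beta> x + flip_sum \<alpha> \<beta> y"
proof -
  obtain u a where x: "x = u @ [a]"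
    using assms(1) by (cases x rule: rev_cases) auto
  then have "y = a # tl y"
    using assms by (cases y) auto
  then show ?thesis
    using flip_sum_append[of \<alpha> \<beta> u a "tl y"] by (simp add: x)
qed

lemma flip_sum_rev: "flip_sum \<alpha> \<beta> (rev w) = - flip_sum \<alpha> \<beta> w"
proof (induction w rule: induct_list012)
  case (3 x y zs)
  have "flip_sum \<alpha> \<beta> (rev (x # y # zs)) = flip_sum \<alpha> \<beta> (rev zs @ [y]) + signed_flip \<alpha> \<beta> y x"
    using flip_sum_append[of \<alpha> \<beta> "rev zs" y "[x]"] by simp
  then show ?case
    using 3(2) signed_flip_anti[of \<alpha> \<beta> y x] by simp
qed simp_all

lemma flip_sum_conjugate:
  assumes "p \<noteq> []" "w \<noteq> []" "last p = hd w" "hd w = last w"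
  shows "flip_sum \<alpha> \<beta> (p @ tl w @ tl (rev p)) = flip_sum \<alpha> \<beta> w"
  using flip_sum_concat[of p w \<alpha> \<beta>] flip_sum_concat[of "p @ tl w" "rev p" \<alpha> \<beta>] last_concat[of p w]
    flip_sum_rev[of \<alpha> \<beta> p] assms by (simp add: hd_rev)

lemma flip_sum_homotopic:
  assumes "discrete_homotopic n T\<^sub>0 w w'" "crossing \<alpha> \<beta>"
  shows "flip_sum \<alpha> \<beta> w = flip_sum \<alpha> \<beta> w'"
  using assms(1)
proof induction
  case (stretch u x v)
  show ?case
    using flip_sum_append[of \<alpha> \<beta> u x v] flip_sum_append[of \<alpha> \<beta> u x "x # v"] by (simp add: signed_flip_self)
next
  case (grid w w')
  then show ?case
    using flip_sum_grid[of n w w' \<alpha> \<beta>] assms(2)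
    by (auto simp: discrete_loops_def discrete_path_def signed_flip_self)
qed auto

text \<open>Commutators die because the integers are abelian; the kernel is a subgroup and so
  contains all that they generate.\<close>

lemma (in group) derived_subset_kernel:
  fixes \<psi> :: "'a \<Rightarrow> int"
  assumes hom: "\<And>x y. x \<in> carrier G \<Longrightarrow> y \<in> carrier G \<Longrightarrow> \<psi> (x \<otimes> y) = \<psi> x + \<psi> y"
    and h: "h \<in> derived G (carrier G)"
  shows "\<psi> h = 0"
proof -
  have one: "\<psi> \<one> = 0"
    using hom[of \<one> \<one>] by simp
  have inv: "\<psi> (inv x) = - \<psi> x" if "x \<in> carrier G" for x
    using hom[of x "inv x"] that one by simp
  define K where "K = {x \<in> carrier G. \<psi> x = 0}"
  have "subgroup K G"
    by (rule subgroupI) (auto simp: K_def one inv hom)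
  moreover have "derived_set G (carrier G) \<subseteq> K"
    by (auto simp: K_def hom inv)
  ultimately have "derived G (carrier G) \<subseteq> K"
    unfolding derived_def using generate_subgroup_incl by blast
  then show ?thesis
    using h by (auto simp: K_def)
qed

lemma represents_ab_flip_sum:
  assumes T0: "T\<^sub>0 \<in> triangulations n" and cr: "crossing \<alpha> \<beta>"
    and w: "discrete_path n w" "hd w = last w" and w': "discrete_path n w'" "hd w' = last w'"
    and rep: "represents_ab n T\<^sub>0 w g" "represents_ab n T\<^sub>0 w' g"
  shows "flip_sum \<alpha> \<beta> w = flip_sum \<alpha> \<beta> w'"
proof -
  interpret group "A1 n T\<^sub>0"
    by (rule A1_group[OF T0])
  let ?H = "derived (A1 n T\<^sub>0) (carrier (A1 n T\<^sub>0))"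
  \<comment> \<open>Any representative will do, because the sum is constant on homotopy
    classes.\<close>
  define \<psi> where "\<psi> X = flip_sum \<alpha> \<beta> (SOME w. w \<in> X)" for X
  have \<psi>: "\<psi> (homotopy_class n T\<^sub>0 u) = flip_sum \<alpha> \<beta> u" if "u \<in> discrete_loops n T\<^sub>0" for u
  proof -
    have "(SOME w. w \<in> homotopy_class n T\<^sub>0 u) \<in> homotopy_class n T\<^sub>0 u"
      using class_self[OF that] someI by metis
    then show ?thesis
      using flip_sum_homotopic[OF _ cr] by (auto simp: \<psi>_def homotopy_class_def)
  qed
  have hom: "\<psi> (X \<otimes>\<^bsub>A1 n T\<^sub>0\<^esub> Y) = \<psi> X + \<psi> Y"
    if "X \<in> carrier (A1 n T\<^sub>0)" "Y \<in> carrier (A1 n T\<^sub>0)" for X Y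
  proof -
    obtain u v where uv: "X = homotopy_class n T\<^sub>0 u" "Y = homotopy_class n T\<^sub>0 v"
      "u \<in> discrete_loops n T\<^sub>0" "v \<in> discrete_loops n T\<^sub>0"
      using \<open>X \<in> _\<close> \<open>Y \<in> _\<close> by (auto simp: carrier_A1)
    moreover have "flip_sum \<alpha> \<beta> (u @ tl v) = flip_sum \<alpha> \<beta> u + flip_sum \<alpha> \<beta> v"
      using uv(3,4) by (intro flip_sum_concat) (auto simp: discrete_loops_def discrete_path_def)
    ultimately show ?thesis
      by (simp add: A1_mult \<psi> loop_concat)
  qed
  obtain p where p: "discrete_path n p" "hd p = T\<^sub>0" "last p = hd w"
    and g: "g = ?H #>\<^bsub>A1 n T\<^sub>0\<^esub> homotopy_class n T\<^sub>0 (p @ tl w @ tl (rev p))"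
    using rep(1) by (auto simp: represents_ab_def)
  obtain p' where p': "discrete_path n p'" "hd p' = T\<^sub>0" "last p' = hd w'"
    and g': "g = ?H #>\<^bsub>A1 n T\<^sub>0\<^esub> homotopy_class n T\<^sub>0 (p' @ tl w' @ tl (rev p'))"
    using rep(2) by (auto simp: represents_ab_def)
  let ?l = "p @ tl w @ tl (rev p)" and ?l' = "p' @ tl w' @ tl (rev p')"
  have loops: "?l \<in> discrete_loops n T\<^sub>0" "?l' \<in> discrete_loops n T\<^sub>0"
    using conjugate_loop p p' w w' by blast+
  then have carr: "homotopy_class n T\<^sub>0 ?l \<in> carrier (A1 n T\<^sub>0)" "homotopy_class n T\<^sub>0 ?l' \<in> carrier (A1 n T\<^sub>0)"
    by (simp_all add: carrier_A1)
  have sub: "subgroup ?H (A1 n T\<^sub>0)"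
    by (rule derived_is_subgroup) simp
  \<comment> \<open>Equal cosets make the two classes differ by a factor from the derived subgroup,
    on which \<open>\<psi>\<close> vanishes.\<close>
  have "homotopy_class n T\<^sub>0 ?l \<in> ?H #>\<^bsub>A1 n T\<^sub>0\<^esub> homotopy_class n T\<^sub>0 ?l'"
    using rcos_self[OF carr(1) sub] g g' by simp
  then obtain h where h: "h \<in> ?H" "homotopy_class n T\<^sub>0 ?l = h \<otimes>\<^bsub>A1 n T\<^sub>0\<^esub> homotopy_class n T\<^sub>0 ?l'"
    by (auto simp: r_coset_def)
  then have "h \<in> carrier (A1 n T\<^sub>0)" (is ?h)
    using subgroup.mem_carrier[OF sub] by blast
  then have "\<psi> (homotopy_class n T\<^sub>0 ?l) = \<psi> (homotopy_class n T\<^sub>0 ?l')"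
    using hom[OF \<open>?h\<close> carr(2)] h(2) derived_subset_kernel[OF hom h(1)] by simp
  then have "flip_sum \<alpha> \<beta> ?l = flip_sum \<alpha> \<beta> ?l'"
    using \<psi> loops by simp
  moreover have "p \<noteq> []" "p' \<noteq> []" "w \<noteq> []" "w' \<noteq> []"
    using p p' w w' by (auto simp: discrete_path_def)
  ultimately show ?thesis
    using flip_sum_conjugate[of p w] flip_sum_conjugate[of p' w'] p p' w w' by simp
qed

section \<open>Comparison of geodesic 5-cycles\<close>

lemma flip_sum_nonzeroD:
  assumes "flip_sum \<alpha> \<beta> w \<noteq> 0"
  shows "\<exists>T\<in>set w. \<exists>T'\<in>set w. signed_flip \<alpha> \<beta> T T' \<noteq> 0"
  using assms by (induction w rule: induct_list012) fastforce+

context pentagon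
begin

lemma diag_in_tri_iff: "i < 5 \<Longrightarrow> k < 5 \<Longrightarrow> diag i \<in> tri k \<longleftrightarrow> i = k \<or> i = Suc k mod 5"
  using diag_eq_iff[of i k] diag_eq_iff[of i "Suc k mod 5"] diag_notin by (simp add: tri_eq)

definition walk :: "segment set list" where
  "walk = map tri [0, 1, 2, 3, 4, 5]"

lemma tri_5: "tri 5 = tri 0"
  using tri_mod[of 5] by simp

lemma walk_traverses: "traverses n walk (geodesic_5_cycle_of n D)"
proof -
  have "successively (flip n) walk"
    using flip_tri_Suc[of 0] flip_tri_Suc[of 1] flip_tri_Suc[of 2] flip_tri_Suc[of 3] flip_tri_Suc[of 4]
    by (simp add: walk_def eval_nat_numeral)
  moreover have "{..<5} = {0, 1, 2, 3, 4::nat}"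
    by auto
  moreover have "distinct (map tri [0, 1, 2, 3, 4])"
    using tri_inj by (subst distinct_map) (auto simp: \<open>{..<5} = _\<close>)
  ultimately show ?thesis
    by (auto simp: traverses_def cycle_of_eq walk_def tri_5)
qed

text \<open>Start and orientation of a traversal are arbitrary, which leaves only the absolute
  value. Flips join only neighbouring indices and the entries before the last are distinct, so a
  traversal never turns back.\<close>

lemma flip_sum_traverse:
  assumes w: "traverses n w (geodesic_5_cycle_of n D)"
  shows "\<bar>flip_sum \<alpha> \<beta> w\<bar> = \<bar>flip_sum \<alpha> \<beta> walk\<bar>"
proof -
  define sg where "sg k = signed_flip \<alpha> \<beta> (tri k) (tri (Suc k mod 5))" for k
  have walk: "flip_sum \<alpha> \<beta> walk = sg 0 + sg 1 + sg 2 + sg 3 + sg 4"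
    by (simp add: walk_def sg_def tri_5 numeral_2_eq_2[symmetric])
  have len: "length w = 6" and cl: "hd w = last w" and dist: "distinct (butlast w)"
    and set: "set w = tri ` {..<5}" and succ: "successively (flip n) w"
    using w by (auto simp: traverses_def cycle_of_eq)
  obtain x0 x1 x2 x3 x4 x5 where "w = [x0, x1, x2, x3, x4, x5]"
    using len by (auto simp: eval_nat_numeral length_Suc_conv)
  with cl have wx: "w = [x0, x1, x2, x3, x4, x0]"
    by simp
  have "x0 \<in> tri ` {..<5}" "x1 \<in> tri ` {..<5}" "x2 \<in> tri ` {..<5}" "x3 \<in> tri ` {..<5}" "x4 \<in> tri ` {..<5}"
    using set unfolding wx by auto
  then obtain i0 i1 i2 i3 i4 where x: "x0 = tri i0" "x1 = tri i1" "x2 = tri i2" "x3 = tri i3" "x4 = tri i4"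
    and lt: "i0 < 5" "i1 < 5" "i2 < 5" "i3 < 5" "i4 < 5"
    by auto
  have flips: "flip n (tri i0) (tri i1)" "flip n (tri i1) (tri i2)" "flip n (tri i2) (tri i3)"
    "flip n (tri i3) (tri i4)" "flip n (tri i4) (tri i0)"
    using succ unfolding wx x by simp_all
  have neq: "i0 \<noteq> i2" "i1 \<noteq> i3" "i2 \<noteq> i4" "i3 \<noteq> i0"
    using dist unfolding wx x by auto
  have sum: "flip_sum \<alpha> \<beta> w = signed_flip \<alpha> \<beta> (tri i0) (tri i1) + signed_flip \<alpha> \<beta> (tri i1) (tri i2) +
      signed_flip \<alpha> \<beta> (tri i2) (tri i3) + signed_flip \<alpha> \<beta> (tri i3) (tri i4) + signed_flip \<alpha> \<beta> (tri i4) (tri i0)"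
    by (simp add: wx x)
  \<comment> \<open>Having reached \<open>b\<close> by a step up from \<open>a\<close>, the walk
    cannot return to \<open>a\<close>, so it steps up again.\<close>
  have forward: "c = Suc b mod 5" if "flip n (tri b) (tri c)" "b = Suc a mod 5" "a \<noteq> c" "a < 5" "b < 5" "c < 5" for a b c
  proof -
    have "Suc a mod 5 \<noteq> Suc c mod 5"
      using that(3,4,6) by (auto simp: mod_Suc)
    then show ?thesis
      using flip_tri_adjacent[OF that(1,5,6)] that(2) by auto
  qed
  have backward: "b = Suc c mod 5" if "flip n (tri b) (tri c)" "a = Suc b mod 5" "a \<noteq> c" "b < 5" "c < 5" for a b c
    using flip_tri_adjacent[OF that(1,4,5)] that(2,3) by auto
  \<comment> \<open>A change of starting point permutes the five summands cyclically.\<close>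
  have cyclic: "sg i + sg (Suc i mod 5) + sg (Suc (Suc i) mod 5) + sg (Suc (Suc (Suc i)) mod 5) +
      sg (Suc (Suc (Suc (Suc i))) mod 5) = flip_sum \<alpha> \<beta> walk" if "i < 5" for i
    using that unfolding walk by (elim less_5_cases; hypsubst; simp add: numeral_2_eq_2[symmetric])
  show ?thesis
    using flip_tri_adjacent[OF flips(1) lt(1,2)]
  proof
    assume 1: "i1 = Suc i0 mod 5"
    have 2: "i2 = Suc i1 mod 5"
      using forward[OF flips(2) 1 neq(1) lt(1,2,3)] .
    have 3: "i3 = Suc i2 mod 5"
      using forward[OF flips(3) 2 neq(2) lt(2,3,4)] .
    have 4: "i4 = Suc i3 mod 5"
      using forward[OF flips(4) 3 neq(3) lt(3,4,5)] .
    have 5: "i0 = Suc i4 mod 5"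
      using forward[OF flips(5) 4 neq(4) lt(4,5,1)] .
    have "flip_sum \<alpha> \<beta> w = sg i0 + sg i1 + sg i2 + sg i3 + sg i4"
      unfolding sum sg_def 1[symmetric] 2[symmetric] 3[symmetric] 4[symmetric] 5[symmetric] ..
    also have "\<dots> = flip_sum \<alpha> \<beta> walk"
      using cyclic[OF lt(1)] 1 2 3 4 by (simp add: mod_Suc_eq)
    finally show ?thesis
      by simp
  next
    assume 1: "i0 = Suc i1 mod 5"
    have 2: "i1 = Suc i2 mod 5"
      using backward[OF flips(2) 1 neq(1) lt(2,3)] .
    have 3: "i2 = Suc i3 mod 5"
      using backward[OF flips(3) 2 neq(2) lt(3,4)] .
    have 4: "i3 = Suc i4 mod 5"
      using backward[OF flips(4) 3 neq(3) lt(4,5)] .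
    have 5: "i4 = Suc i0 mod 5"
      using backward[OF flips(5) 4 neq(4) lt(5,1)] .
    have sg: "sg i1 = - signed_flip \<alpha> \<beta> (tri i0) (tri i1)" "sg i2 = - signed_flip \<alpha> \<beta> (tri i1) (tri i2)"
      "sg i3 = - signed_flip \<alpha> \<beta> (tri i2) (tri i3)" "sg i4 = - signed_flip \<alpha> \<beta> (tri i3) (tri i4)"
      "sg i0 = - signed_flip \<alpha> \<beta> (tri i4) (tri i0)"
      unfolding sg_def 1[symmetric] 2[symmetric] 3[symmetric] 4[symmetric] 5[symmetric]
      by (rule signed_flip_anti)+
    have "sg i0 + sg i4 + sg i3 + sg i2 + sg i1 = flip_sum \<alpha> \<beta> walk"
    proof -
      have "i4 = Suc i0 mod 5" "i3 = Suc (Suc i0) mod 5" "i2 = Suc (Suc (Suc i0)) mod 5"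
        "i1 = Suc (Suc (Suc (Suc i0))) mod 5"
        using 5 4 3 2 by (simp_all add: mod_Suc_eq)
      then show ?thesis
        using cyclic[OF lt(1)] by simp
    qed
    then have "flip_sum \<alpha> \<beta> w = - flip_sum \<alpha> \<beta> walk"
      using sum sg by linarith
    then show ?thesis
      by simp
  qed
qed

text \<open>Only the step out of \<open>tri i\<close> contributes. The two choices of
  \<open>i\<close> involve \<open>diag 0\<close>, \<open>diag 2\<close> and \<open>diag 4\<close>,
  whose ends are all the vertices of the pentagon.\<close>

lemma flip_sum_walk:
  assumes "i = 0 \<or> i = 2"
  shows "flip_sum (diag i) (diag (i + 2)) walk = 1"
  using assms by (elim disjE) (simp_all add: walk_def signed_flip_def diag_in_tri_iff tri_5)

text \<open>Neither segment can lie in \<open>D\<close>: it would then belong to both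
  triangulations, one of which contains the other segment, and the two cross.\<close>

lemma signed_flip_cycleD:
  assumes T: "T \<in> geodesic_5_cycle_of n D" "T' \<in> geodesic_5_cycle_of n D"
    and cr: "crossing \<alpha> \<beta>" and nz: "signed_flip \<alpha> \<beta> T T' \<noteq> 0"
  shows "\<alpha> \<in> range diag \<and> \<beta> \<in> range diag"
proof -
  obtain i j where ij: "T = tri i" "T' = tri j"
    using T by (auto simp: cycle_of_eq)
  have "\<not> (\<alpha> \<in> tri i \<and> \<beta> \<in> tri i)" "\<not> (\<alpha> \<in> tri j \<and> \<beta> \<in> tri j)"
    using triangulation_crossing_notin[OF tri_triangulation cr] by auto
  moreover have "\<alpha> \<in> T \<and> \<beta> \<in> T' \<or> \<beta> \<in> T \<and> \<alpha> \<in> T'"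
    using nz by (auto simp: signed_flip_def of_bool_def split: if_splits)
  ultimately show ?thesis
    by (auto simp: ij tri_def)
qed

lemma diag_endpoints: "diag i = (a, b) \<Longrightarrow> a \<in> {v0, v1, v2, v3, v4} \<and> b \<in> {v0, v1, v2, v3, v4}"
  using diag_cases[of i] by auto

lemma walk_path: "discrete_path n walk" "hd walk = tri 0" "last walk = tri 0"
proof -
  have "successively (near n) walk"
    using walk_traverses flip_near by (auto simp: traverses_def elim: successively_mono)
  then show "discrete_path n walk"
    using tri_triangulation by (auto simp: discrete_path_def walk_def)
qed (simp_all add: walk_def tri_5)

text \<open>A flip of \<open>tri 0\<close> that keeps its two pentagon diagonals replaces some
  \<open>d\<close> in \<open>D\<close>. As the sides survive too, the same replacement works in all
  five triangulations, which gives a grid between the two walks.\<close>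

lemma exchange_outside:
  assumes flip: "flip n (tri 0) U" and U: "diag 0 \<in> U" "diag (Suc 0) \<in> U"
    and sides: "{(v0, v1), (v1, v2), (v2, v3), (v3, v4), (v0, v4)} \<subseteq> sides n U"
  shows "pentagon n (U - {diag 0, diag (Suc 0)}) v0 v1 v2 v3 v4"
    and "list_all2 (near n) walk (pentagon.walk (U - {diag 0, diag (Suc 0)}) v0 v1 v2 v3 v4)"
proof -
  let ?D = "U - {diag 0, diag (Suc 0)}"
  have triU: "U \<in> triangulations n"
    using flip_triangulation[OF flip] by simp
  \<comment> \<open>Each of the other three pentagon diagonals crosses \<open>diag 0\<close> or
    \<open>diag (Suc 0)\<close>, so the flip has introduced none of them.\<close>
  have cross: "crossing (diag 2) (diag 0)" "crossing (diag 3) (diag 0)" "crossing (diag 4) (diag (Suc 0))"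
    by (simp_all add: crossing_diag_iff)
  have notin: "diag 2 \<notin> U" "diag 3 \<notin> U" "diag 4 \<notin> U"
    using cross U triangulation_crossing_notin[OF triU] by blast+
  show pent: "pentagon n ?D v0 v1 v2 v3 v4"
  proof
    show "?D \<in> noncrossing_sets n"
      using triangulation_noncrossing_set[OF triU] by (auto simp: noncrossing_sets_def)
    have "card {diag 0, diag (Suc 0)} = 2" "{diag 0, diag (Suc 0)} \<subseteq> U"
      using diag_Suc_neq[of 0] U by auto
    then show "card ?D + 2 = n"
      using card_Diff_subset[of "{diag 0, diag (Suc 0)}" U] triangulation_card[OF triU]
        card_mono[OF triangulation_finite[OF triU], of "{diag 0, diag (Suc 0)}"] by auto
    show "{(v0, v1), (v1, v2), (v2, v3), (v3, v4), (v0, v4)} \<subseteq> sides n ?D"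
      using sides less by (auto simp: diag_simps)
    show "{(v0, v2), (v0, v3), (v1, v3), (v1, v4), (v2, v4)} \<inter> ?D = {}"
      using notin by (auto simp: diag_simps)
  qed (use less in_P in auto)
  interpret U: pentagon n ?D v0 v1 v2 v3 v4
    by (rule pent)
  obtain d d' where d: "d \<in> tri 0" "d' \<notin> tri 0" "U = insert d' (tri 0 - {d})"
    using flip by (auto simp: flip_def)
  have tri0: "tri 0 = insert (diag 0) (insert (diag (Suc 0)) D)"
    by (simp add: tri_def)
  have "d \<notin> {diag 0, diag (Suc 0)}"
    using d U by auto
  then have dD: "d \<in> D"
    using d(1) tri0 by auto
  have "d' \<in> ?D"
    using d(2,3) tri0 by auto
  then have d'_diag: "d' \<noteq> diag i" for i
    using U.diag_notin[of i] by auto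
  have D_eq: "?D = insert d' (D - {d})"
    using d(2,3) tri0 diag_notin \<open>d \<notin> {diag 0, diag (Suc 0)}\<close> by auto
  have near: "near n (tri i) (U.tri i)" for i
  proof -
    have "U.tri i = insert d' (tri i - {d})"
      using D_eq dD diag_notin unfolding U.tri_def tri_def by auto
    moreover have "d \<in> tri i" "d' \<notin> tri i"
      using dD d(2) d'_diag tri0 by (auto simp: tri_def)
    ultimately have "flip n (tri i) (U.tri i)"
      unfolding flip_def using tri_triangulation U.tri_triangulation by blast
    then show ?thesis
      by (rule flip_near)
  qed
  show "list_all2 (near n) walk U.walk"
    unfolding walk_def U.walk_def list.map by (intro list_all2_Cons[THEN iffD2] conjI near list_all2_Nil[THEN iffD2]) simp
qed

end

section \<open>Transport of a cycle along flips outside its pentagon\<close>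

lemma flips_path:
  assumes "(flip_keeping n F)\<^sup>*\<^sup>* T T'" "T \<in> triangulations n"
  shows "\<exists>p. discrete_path n p \<and> hd p = T \<and> last p = T'"
  using assms(1)
proof induction
  case base
  have "discrete_path n [T]"
    using assms(2) by (simp add: discrete_path_single)
  then show ?case
    by (intro exI[of _ "[T]"]) simp
next
  case (step U V)
  then obtain p where p: "discrete_path n p" "hd p = T" "last p = U"
    by blast
  have "near n U V" "V \<in> triangulations n" "p \<noteq> []"
    using step p flip_near flip_triangulation by (auto simp: flip_keeping_def discrete_path_def)
  then have "discrete_path n (p @ [V])"
    using p by (simp add: discrete_path_append_iff discrete_path_single)
  then show ?case
    using p \<open>p \<noteq> []\<close> by (intro exI[of _ "p @ [V]"]) simp
qed

text \<open>Each flip of a chain outside the pentagon moves the walk through one grid and prolongs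
  the joining path by one entry.\<close>

lemma same_pentagon_homotopic:
  assumes pent: "pentagon n D v0 v1 v2 v3 v4" "pentagon n D' v0 v1 v2 v3 v4"
    and T0: "T\<^sub>0 \<in> triangulations n"
  defines "w \<equiv> pentagon.walk D v0 v1 v2 v3 v4" and "w' \<equiv> pentagon.walk D' v0 v1 v2 v3 v4"
  shows "\<exists>p p'. discrete_path n p \<and> hd p = T\<^sub>0 \<and> last p = hd w \<and> discrete_path n p' \<and> hd p' = T\<^sub>0 \<and> last p' = hd w' \<and>
    discrete_homotopic n T\<^sub>0 (p @ tl w @ tl (rev p)) (p' @ tl w' @ tl (rev p'))"
proof -
  interpret A: pentagon n D v0 v1 v2 v3 v4
    by (rule pent(1))
  interpret B: pentagon n D' v0 v1 v2 v3 v4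
    by (rule pent(2))
  let ?E = "{A.diag 0, A.diag (Suc 0)}"
  let ?sides = "{(v0, v1), (v1, v2), (v2, v3), (v3, v4), (v0, v4)}"
  \<comment> \<open>Keeping this set protects the pentagon: it contains two of its diagonals and all
    its sides that are not edges of the polygon.\<close>
  define F where "F = A.tri 0 \<inter> B.tri 0"
  have E: "?E \<subseteq> F"
    by (auto simp: F_def A.tri_def B.tri_def)
  have F_sides: "?sides \<subseteq> sides n F"
    using A.pent_sides B.pent_sides by (auto simp: F_def A.tri_def B.tri_def)
  obtain p where p: "discrete_path n p" "hd p = T\<^sub>0" "last p = A.tri 0"
    using flips_path[OF flips_connect[OF T0 A.tri_triangulation[of 0], of "{}"] T0] by auto
  have "(flip_keeping n F)\<^sup>*\<^sup>* (A.tri 0) (B.tri 0)"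
    by (rule flips_connect) (auto simp: F_def A.tri_triangulation B.tri_triangulation)
  \<comment> \<open>The dissection belonging to an intermediate triangulation is recovered by
    removing the two pentagon diagonals.\<close>
  then have "F \<subseteq> B.tri 0 \<and> pentagon n (B.tri 0 - ?E) v0 v1 v2 v3 v4 \<and>
    (\<exists>p'. discrete_path n p' \<and> hd p' = T\<^sub>0 \<and> last p' = B.tri 0 \<and>
      discrete_homotopic n T\<^sub>0 (p @ tl w @ tl (rev p))
        (p' @ tl (pentagon.walk (B.tri 0 - ?E) v0 v1 v2 v3 v4) @ tl (rev p')))"
  proof (induction rule: rtranclp_induct)
    case base
    have D: "A.tri 0 - ?E = D"
      using A.diag_notin by (auto simp: A.tri_def)
    have "p @ tl w @ tl (rev p) \<in> discrete_loops n T\<^sub>0"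
      using conjugate_loop[OF p(1,2)] p(3) A.walk_path by (simp add: w_def)
    then show ?case
      unfolding D using p pent(1) F_def by (auto simp: w_def intro!: exI[of _ p] discrete_homotopic.refl)
  next
    case (step U V)
    then obtain q where q: "discrete_path n q" "hd q = T\<^sub>0" "last q = U"
      and hom: "discrete_homotopic n T\<^sub>0 (p @ tl w @ tl (rev p))
        (q @ tl (pentagon.walk (U - ?E) v0 v1 v2 v3 v4) @ tl (rev q))"
      and pU: "pentagon n (U - ?E) v0 v1 v2 v3 v4" and FU: "F \<subseteq> U"
      by blast
    interpret U: pentagon n "U - ?E" v0 v1 v2 v3 v4
      by (rule pU)
    have U: "U.tri 0 = U"
      unfolding U.tri_def using E FU by auto
    have flip: "flip n (U.tri 0) V" and FV: "F \<subseteq> V"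
      using step.hyps(2) by (auto simp: flip_keeping_def U)
    have V: "A.diag 0 \<in> V" "A.diag (Suc 0) \<in> V" "?sides \<subseteq> sides n V"
      using E FV F_sides by auto
    note ex = U.exchange_outside[OF flip V]
    interpret V: pentagon n "V - ?E" v0 v1 v2 v3 v4
      by (rule ex(1))
    have hdV: "hd V.walk = V"
      unfolding V.walk_path(2) V.tri_def using V by auto
    have "last q = hd U.walk"
      using q U U.walk_path by simp
    note g = grid_conjugate_homotopic[OF q(1,2) this U.walk_path(1) _ V.walk_path(1) _ ex(2)]
    have "discrete_path n (q @ [V])"
      "discrete_homotopic n T\<^sub>0 (q @ tl U.walk @ tl (rev q)) ((q @ [V]) @ tl V.walk @ tl (rev (q @ [V])))"
      using g U.walk_path V.walk_path unfolding hdV by auto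
    moreover have "hd (q @ [V]) = T\<^sub>0" "last (q @ [V]) = V"
      using q by (auto simp: discrete_path_def)
    ultimately show ?case
      using FV ex(1) hom discrete_homotopic.trans by blast
  qed
  moreover have "B.tri 0 - ?E = D'"
    using B.diag_notin by (auto simp: B.tri_def)
  ultimately obtain p' where "discrete_path n p'" "hd p' = T\<^sub>0" "last p' = B.tri 0"
    "discrete_homotopic n T\<^sub>0 (p @ tl w @ tl (rev p)) (p' @ tl w' @ tl (rev p'))"
    by (auto simp: w'_def)
  then show ?thesis
    using p A.walk_path(2) B.walk_path(2) unfolding w_def w'_def by metis
qed

lemma traverses_path:
  assumes "traverses n w C"
  shows "discrete_path n w" "hd w = last w"
proof -
  have "w \<noteq> []" and succ: "successively (flip n) w" and "length w = 6"
    using assms by (auto simp: traverses_def)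
  have "T \<in> triangulations n" if T: "T \<in> set w" for T
  proof -
    obtain i where i: "i < length w" "w ! i = T"
      using T by (auto simp: in_set_conv_nth)
    show ?thesis
    proof (cases "Suc i < length w")
      case True
      then show ?thesis
        using successively_nth[OF succ] i flip_triangulation by blast
    next
      case False
      then have "flip n (w ! (i - 1)) (w ! i)"
        using successively_nth[OF succ, of "i - 1"] i \<open>length w = 6\<close> by simp
      then show ?thesis
        using i flip_triangulation by blast
    qed
  qed
  then show "discrete_path n w"
    using \<open>w \<noteq> []\<close> succ flip_near by (auto simp: discrete_path_def elim: successively_mono)
  show "hd w = last w"
    using assms by (simp add: traverses_def)
qed

section \<open>The two directions of the equivalence\<close>

text \<open>The conjugated walks are homotopic, so they have equal classes in \<open>A1\<close> and
  hence the same coset \<open>g\<close>.\<close>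

lemma equal_labels_A_equivalent:
  assumes T0: "T\<^sub>0 \<in> triangulations n"
    and pent: "pentagon n D v0 v1 v2 v3 v4" "pentagon n D' v0 v1 v2 v3 v4"
  shows "A_equivalent n T\<^sub>0 (geodesic_5_cycle_of n D) (geodesic_5_cycle_of n D')"
proof -
  interpret A: pentagon n D v0 v1 v2 v3 v4
    by (rule pent(1))
  interpret B: pentagon n D' v0 v1 v2 v3 v4
    by (rule pent(2))
  let ?H = "derived (A1 n T\<^sub>0) (carrier (A1 n T\<^sub>0))"
  obtain p p' where p: "discrete_path n p" "hd p = T\<^sub>0" "last p = hd A.walk"
    and p': "discrete_path n p'" "hd p' = T\<^sub>0" "last p' = hd B.walk"
    and hom: "discrete_homotopic n T\<^sub>0 (p @ tl A.walk @ tl (rev p)) (p' @ tl B.walk @ tl (rev p'))"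
    using same_pentagon_homotopic[OF pent T0] by blast
  define g where "g = ?H #>\<^bsub>A1 n T\<^sub>0\<^esub> homotopy_class n T\<^sub>0 (p @ tl A.walk @ tl (rev p))"
  have "p @ tl A.walk @ tl (rev p) \<in> discrete_loops n T\<^sub>0"
    using homotopic_loops[OF hom] by simp
  then have "g \<in> carrier (abelianization (A1 n T\<^sub>0))"
    unfolding g_def abelianization_def FactGroup_def RCOSETS_def by (auto simp: carrier_A1)
  moreover have "represents_ab n T\<^sub>0 A.walk g"
    using p unfolding represents_ab_def g_def by blast
  moreover have "represents_ab n T\<^sub>0 B.walk g"
    using p' unfolding represents_ab_def g_def class_eq[OF hom] by blast
  ultimately show ?thesis
    unfolding A_equivalent_def using A.walk_traverses B.walk_traverses by blast
qed

text \<open>The pairs \<open>diag 0\<close>, \<open>diag 2\<close> and \<open>diag 2\<close>,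
  \<open>diag 4\<close> of the first pentagon have nonzero count around both cycles. Hence two
  triangulations of the second cycle exchange them, and they are diagonals of the second pentagon.
  Their ends are all five vertices of the first.\<close>

lemma A_equivalent_equal_labels:
  assumes T0: "T\<^sub>0 \<in> triangulations n"
    and pent: "pentagon n D v0 v1 v2 v3 v4" "pentagon n D' u0 u1 u2 u3 u4"
    and equiv: "A_equivalent n T\<^sub>0 (geodesic_5_cycle_of n D) (geodesic_5_cycle_of n D')"
  shows "{v0, v1, v2, v3, v4} \<subseteq> {u0, u1, u2, u3, u4}"
proof -
  interpret A: pentagon n D v0 v1 v2 v3 v4
    by (rule pent(1))
  interpret B: pentagon n D' u0 u1 u2 u3 u4
    by (rule pent(2))
  obtain w w' g where w: "traverses n w (geodesic_5_cycle_of n D)" and w': "traverses n w' (geodesic_5_cycle_of n D')"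
    and rep: "represents_ab n T\<^sub>0 w g" "represents_ab n T\<^sub>0 w' g"
    using equiv by (auto simp: A_equivalent_def)
  have "A.diag i \<in> range B.diag \<and> A.diag (i + 2) \<in> range B.diag" if i: "i = 0 \<or> i = 2" for i
  proof -
    have cr: "crossing (A.diag i) (A.diag (i + 2))"
      using i by (elim disjE) (simp_all add: A.crossing_diag_iff)
    have "flip_sum (A.diag i) (A.diag (i + 2)) w = flip_sum (A.diag i) (A.diag (i + 2)) w'"
      by (rule represents_ab_flip_sum[OF T0 cr traverses_path[OF w] traverses_path[OF w'] rep])
    then have "flip_sum (A.diag i) (A.diag (i + 2)) w' \<noteq> 0"
      using A.flip_sum_traverse[OF w, of "A.diag i" "A.diag (i + 2)"] A.flip_sum_walk[OF i] by auto
    then obtain T T' where "T \<in> set w'" "T' \<in> set w'" "signed_flip (A.diag i) (A.diag (i + 2)) T T' \<noteq> 0"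
      using flip_sum_nonzeroD by blast
    moreover have "set w' = geodesic_5_cycle_of n D'"
      using w' by (simp add: traverses_def)
    ultimately show ?thesis
      using B.signed_flip_cycleD cr by blast
  qed
  from this[of 0] this[of 2] have "(v0, v2) \<in> range B.diag" "(v1, v3) \<in> range B.diag" "(v2, v4) \<in> range B.diag"
    by (simp_all add: A.diag_simps)
  moreover have "a \<in> {u0, u1, u2, u3, u4} \<and> b \<in> {u0, u1, u2, u3, u4}" if "(a, b) \<in> range B.diag" for a b
    using that B.diag_endpoints by (metis rangeE)
  ultimately show ?thesis
    by blast
qed

theorem theorem4p2:
  fixes n :: nat and T\<^sub>0 :: "segment set" and C C' :: "segment set set"
  assumes "T\<^sub>0 \<in> triangulations n"
    and "geodesic_5_cycle n C"
    and "geodesic_5_cycle n C'"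
  shows "A_equivalent n T\<^sub>0 C C' \<longleftrightarrow> label n C = label n C'"
proof -
  obtain D S where D: "pentagon_dissection n D S" "C = geodesic_5_cycle_of n D"
    using assms(2) by (auto simp: geodesic_5_cycle_def)
  obtain D' S' where D': "pentagon_dissection n D' S'" "C' = geodesic_5_cycle_of n D'"
    using assms(3) by (auto simp: geodesic_5_cycle_def)
  have labels: "label n C = S" "label n C' = S'"
    using label_eq D D' by auto
  have card: "card S = 5" "card S' = 5"
    using D(1) D'(1) by (auto simp: pentagon_dissection_def)
  obtain v0 v1 v2 v3 v4 where v: "S = {v0, v1, v2, v3, v4}" "v0 < v1" "v1 < v2" "v2 < v3" "v3 < v4"
    using card(1) by (rule card_5_sorted)
  obtain u0 u1 u2 u3 u4 where u: "S' = {u0, u1, u2, u3, u4}" "u0 < u1" "u1 < u2" "u2 < u3" "u3 < u4"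
    using card(2) by (rule card_5_sorted)
  note pent = pentagon_dissection_pentagon[OF D(1) v] pentagon_dissection_pentagon[OF D'(1) u]
  show ?thesis
  proof
    assume "A_equivalent n T\<^sub>0 C C'"
    then have "S \<subseteq> S'"
      using A_equivalent_equal_labels[OF assms(1) pent] D(2) D'(2) v(1) u(1) by simp
    \<comment> \<open>One inclusion is enough, as both labels have five elements.\<close>
    then have "S = S'"
      using card card_subset_eq[of S' S] u(1) by simp
    then show "label n C = label n C'"
      using labels by simp
  next
    assume "label n C = label n C'"
    then have "S' = {v0, v1, v2, v3, v4}"
      using labels v(1) by simp
    then show "A_equivalent n T\<^sub>0 C C'"
      using equal_labels_A_equivalent[OF assms(1) pent(1) pentagon_dissection_pentagon[OF D'(1) _ v(2-5)]] D(2) D'(2)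
      by simp
  qed
qed

end
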